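(* Let $\mathcal{A}(s)=sE-A$ with $E,A\in\mathbb{C}^{n\times n}$ be a regular matrix pencil and choose pairwise distinct numbers $\mu_1,\ldots,\mu_l\in\overline{\mathbb{C}}$ with $l\leq M(\mathcal{A})$. Choose multiplicities $m_1,\ldots,m_l\in\mathbb{N}\setminus\{0\}$ with $\sum_{i=1}^lm_i=M(\mathcal{A})$. Then the following statements hold true. (a) There exists a rank one pencil $\mathcal{P}(s)=(\alpha s-\beta)uv^*$ with $\alpha\in\mathbb{C}\setminus\{0\}$, $\beta\in\mathbb{C}$ and $u,v\in\mathbb{C}^n$ such that $(\mathcal{A}+\mathcal{P})(s)$ is regular, and $$\sigma(\mathcal{A}+\mathcal{P})=\{\mu_1,\ldots,\mu_l\}\cup\{\lambda\in\sigma(\mathcal{A}) : \dim\ker\mathcal{A}(\lambda)\geq 2\}\qquad (\ast)$$ with multiplicities $$\dim \mathcal{L}_{\lambda}(\mathcal{A}+\mathcal{P})=\begin{cases}\dim \mathcal{L}_{\lambda}(\mathcal{A})-m_1(\lambda)+m_i, & \text{for }\lambda=\mu_i\in\sigma(\mathcal{A}), \\ \dim \mathcal{L}_{\lambda}(\mathcal{A})-m_1(\lambda), & \text{for }\lambda\in\sigma(\mathcal{A})\setminus\{\mu_1,\ldots,\mu_l\}, \\ m_i, & \text{for }\lambda=\mu_i\notin\sigma(\mathcal{A}), \\ 0, & \text{for }\lambda\notin\sigma(\mathcal{A})\cup\{\mu_1,\ldots,\mu_l\}.\end{cases}\qquad (\ast\ast)$$ (b) If $E,A$ are real matrices and $\{\mu_1,\ldots,\mu_l\}$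 is symmetric with respect to the real line, with $m_i=m_j$ if $\mu_j=\overline{\mu_i}$, for all $i,j=1,\ldots,l$, then there exist $\alpha,\beta\in\mathbb{R}$ and $u,v\in\mathbb{R}^n$ such that $\mathcal{P}(s)=(\alpha s-\beta)uv^T$ satisfies $(\ast)$ and $(\ast\ast)$.
   Context: $\overline{\mathbb{C}}:=\mathbb{C}\cup\{\infty\}$, with $\overline{\infty}=\infty$. A matrix pencil is $\mathcal{A}(s)=sE-A$ with $E,A\in\mathbb{C}^{n\times n}$; sums of pencils are formed pointwise. It is regular if $\det(sE-A)$ is not the zero polynomial. The rank of a pencil is the largest $r\in\mathbb{N}$ such that the pencil, viewed as a matrix with polynomial entries, has a minor of size $r$ that is not the zero polynomial; a rank one pencil is a pencil of rank equal to one. For $\lambda\in\mathbb{C}$, $\mathcal{A}(\lambda)=\lambda E-A$, and $\mathcal{A}(\infty):=E$ (the leading coefficient). The spectrum $\sigma(\mathcal{A})\subseteq\overline{\mathbb{C}}$ is the set of $\lambda\in\overline{\mathbb{C}}$ such that $\mathcal{A}(\lambda)$ is singular. Jordan chains: $\{g_0,\ldots,g_{m-1}\}\subset\mathbb{C}^n$ is a Jordan chain of length $m$ at $\lambda\in\mathbb{C}$ if $g_0\neq0$, $(A-\lambda E)g_0=0$ and $(A-\lambda E)g_j=Eg_{j-1}$ for $1\le j\le m-1$; it is a Jordan chain of length $m$ at $\infty$ if $g_0\neq0$, $Eg_0=0$ and $Eg_j=Ag_{j-1}$ for $1\le j\le m-1$. The root subspace $\mathcal{L}_\lambda(\mathcal{A})$,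 $\lambda\in\overline{\mathbb{C}}$, is the subspace consisting of the zero vector and all elements of all Jordan chains of $\mathcal{A}(s)$ at $\lambda$. For $\lambda\in\sigma(\mathcal{A})$, $m_1(\lambda)$ (a function of the eigenvalue, not to be confused with the chosen multiplicities $m_i$) is the length of the longest Jordan chain of $\mathcal{A}(s)$ at $\lambda$, and $M(\mathcal{A}):=\sum_{\mu\in\sigma(\mathcal{A})}m_1(\mu)$.
   Formalization: In (a), that P has rank exactly one is not asserted when n=1, E=0 and {μ_1,…,μ_l}={∞}; there the claim is false, since a rank one P with α≠0 makes the leading coefficient nonzero, so ∞ is not in σ(A+P). *)

theory Defs
  imports "HOL-Analysis.Analysis" "HOL-Computational_Algebra.Polynomial"
begin

datatype ecomplex = Fin complex | Infty

primrec ecnj :: "ecomplex \<Rightarrow> ecomplex" where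
  "ecnj (Fin z) = Fin (cnj z)"
| "ecnj Infty = Infty"

text \<open>
  The pair \<open>(E, A)\<close> stands for the pencil \<open>s E - A\<close> (note the sign of the second component),
  so the componentwise \<open>+\<close> on pairs is the pointwise sum of pencils.
\<close>

type_synonym 'n pencil = "(complex^'n^'n) \<times> (complex^'n^'n)"

definition pencil_poly :: "'n::finite pencil \<Rightarrow> complex poly^'n^'n" where
  "pencil_poly P = (\<chi> i j. [: - (snd P $ i $ j), fst P $ i $ j :])"

definition regular_pencil :: "'n::finite pencil \<Rightarrow> bool" where
  "regular_pencil P \<longleftrightarrow> det (pencil_poly P) \<noteq> 0"

text \<open>
  The determinant (Leibniz formula) of the \<open>r \<times> r\<close> submatrix with rows \<open>f 0, \<dots>, f (r - 1)\<close> and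
  columns \<open>g 0, \<dots>, g (r - 1)\<close>. It is spelled out because \<^const>\<open>det\<close> needs a type of size \<open>r\<close>.
  The order in which rows and columns are listed only affects the sign.
\<close>

definition minor :: "nat \<Rightarrow> (nat \<Rightarrow> 'n) \<Rightarrow> (nat \<Rightarrow> 'n) \<Rightarrow> 'a::comm_ring_1^'n^'n \<Rightarrow> 'a" where
  "minor r f g B =
     (\<Sum>p\<in>{p. p permutes {..<r}}. of_int (sign p) * (\<Prod>i<r. B $ f i $ g (p i)))"

definition pencil_rank :: "'n::finite pencil \<Rightarrow> nat" where
  "pencil_rank P = Max {r. \<exists>f g. inj_on f {..<r} \<and> inj_on g {..<r} \<and> minor r f g (pencil_poly P) \<noteq> 0}"

fun pencil_at :: "'n::finite pencil \<Rightarrow> ecomplex \<Rightarrow> complex^'n^'n" where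
  "pencil_at (E, A) (Fin z) = mat z ** E - A"
| "pencil_at (E, A) Infty = E"

definition pencil_spectrum :: "'n::finite pencil \<Rightarrow> ecomplex set" where
  "pencil_spectrum P = {z. \<not> invertible (pencil_at P z)}"

definition ker_dim :: "complex^'n^'n::finite \<Rightarrow> nat" where
  "ker_dim B = vec.dim {x. B *v x = 0}"

fun jordan_chain :: "'n::finite pencil \<Rightarrow> ecomplex \<Rightarrow> (complex^'n) list \<Rightarrow> bool" where
  "jordan_chain (E, A) (Fin z) g \<longleftrightarrow>
     g \<noteq> [] \<and> g ! 0 \<noteq> 0 \<and> (A - mat z ** E) *v (g ! 0) = 0 \<and>
     (\<forall>j. 1 \<le> j \<and> j < length g \<longrightarrow> (A - mat z ** E) *v (g ! j) = E *v (g ! (j - 1)))"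
| "jordan_chain (E, A) Infty g \<longleftrightarrow>
     g \<noteq> [] \<and> g ! 0 \<noteq> 0 \<and> E *v (g ! 0) = 0 \<and>
     (\<forall>j. 1 \<le> j \<and> j < length g \<longrightarrow> E *v (g ! j) = A *v (g ! (j - 1)))"

definition root_subspace :: "'n::finite pencil \<Rightarrow> ecomplex \<Rightarrow> (complex^'n) set" where
  "root_subspace P z = {0} \<union> (\<Union>g\<in>{g. jordan_chain P z g}. set g)"

text \<open>
  Used only for eigenvalues of regular pencils, where the set of lengths is finite and nonempty.
\<close>

definition max_chain_length :: "'n::finite pencil \<Rightarrow> ecomplex \<Rightarrow> nat" where
  "max_chain_length P z = Max {length g | g. jordan_chain P z g}"

definition chain_total :: "'n::finite pencil \<Rightarrow> nat" where
  "chain_total P = (\<Sum>z\<in>pencil_spectrum P. max_chain_length P z)"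

text \<open>The pencil \<open>(\<alpha> s - \<beta>) u w\<^sup>T\<close>.\<close>

definition dyad_pencil :: "complex \<Rightarrow> complex \<Rightarrow> complex^'n \<Rightarrow> complex^'n \<Rightarrow> 'n::finite pencil" where
  "dyad_pencil a b u w = ((\<chi> i j. a * (u $ i * w $ j)), (\<chi> i j. b * (u $ i * w $ j)))"

definition vcnj :: "complex^'n \<Rightarrow> complex^'n" where
  "vcnj v = (\<chi> i. cnj (v $ i))"

definition cvec :: "real^'n \<Rightarrow> complex^'n" where
  "cvec v = (\<chi> i. complex_of_real (v $ i))"

definition placed_spectrum ::
  "'n::finite pencil \<Rightarrow> nat \<Rightarrow> (nat \<Rightarrow> ecomplex) \<Rightarrow> 'n pencil \<Rightarrow> bool" where
  "placed_spectrum P l \<mu> Q \<longleftrightarrow>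
     pencil_spectrum Q = \<mu> ` {1..l} \<union> {z \<in> pencil_spectrum P. ker_dim (pencil_at P z) \<ge> 2}"

definition placed_multiplicities ::
  "'n::finite pencil \<Rightarrow> nat \<Rightarrow> (nat \<Rightarrow> ecomplex) \<Rightarrow> (nat \<Rightarrow> nat) \<Rightarrow> 'n pencil \<Rightarrow> bool" where
  "placed_multiplicities P l \<mu> m Q \<longleftrightarrow>
     (\<forall>i\<in>{1..l}. \<mu> i \<in> pencil_spectrum P \<longrightarrow>
        int (vec.dim (root_subspace Q (\<mu> i))) =
          int (vec.dim (root_subspace P (\<mu> i))) - int (max_chain_length P (\<mu> i)) + int (m i)) \<and>
     (\<forall>z\<in>pencil_spectrum P - \<mu> ` {1..l}.
        int (vec.dim (root_subspace Q z)) =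
          int (vec.dim (root_subspace P z)) - int (max_chain_length P z)) \<and>
     (\<forall>i\<in>{1..l}. \<mu> i \<notin> pencil_spectrum P \<longrightarrow> vec.dim (root_subspace Q (\<mu> i)) = m i) \<and>
     (\<forall>z. z \<notin> pencil_spectrum P \<union> \<mu> ` {1..l} \<longrightarrow> vec.dim (root_subspace Q z) = 0)"

end

theory Submission
  imports Defs
    "HOL-Computational_Algebra.Fundamental_Theorem_Algebra"
    "HOL-Computational_Algebra.Polynomial_Factorial"
    "HOL-Computational_Algebra.Field_as_Ring"
begin

text \<open>
  Choose a real \<open>c\<close> that is neither an eigenvalue of the pencil nor one of the \<open>\<mu>\<^sub>i\<close>. Then
  \<open>F = c E - A\<close> is invertible, and with \<open>B = F\<^sup>-\<^sup>1 E\<close> the pencil is \<open>F (1 + (s - c) B)\<close>: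
  its Jordan structure at \<open>s\<close> is that of the matrix \<open>B\<close> at \<open>1 / (c - s)\<close>, where \<open>\<infinity>\<close>
  corresponds to \<open>0\<close>. Adding \<open>(s - c) (F u) w\<^sup>T\<close> to the pencil replaces \<open>B\<close> by \<open>B + u w\<^sup>T\<close>.
  Let \<open>q\<close> be the minimal polynomial of \<open>B\<close>, \<open>d\<close> its degree, which is \<open>M(\<A>)\<close>, and \<open>p\<close> the
  monic polynomial of degree \<open>d\<close> with the prescribed roots. Take a real vector \<open>z\<close> whose local
  minimal polynomial is \<open>q\<close>, put \<open>u = - p(B) z\<close> and let \<open>w\<^sup>T\<close> vanish on \<open>B\<^sup>i z\<close> for
  \<open>i < d - 1\<close> and be \<open>1\<close> on \<open>B\<^sup>d\<^sup>-\<^sup>1 z\<close>. The cyclic subspace of \<open>z\<close> is then also cyclic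
  for \<open>B + u w\<^sup>T\<close>, with \<open>p\<close> in place of \<open>q\<close>, while the map induced on the quotient is unchanged.
\<close>

subsection \<open>Polynomials in a matrix and cyclic subspaces\<close>

text \<open>The vector \<open>f(B) x\<close> by Horner's scheme: the space becomes a module over the
  polynomials, and no matrix powers have to be formed.\<close>

definition act :: "complex^'n^'n \<Rightarrow> complex poly \<Rightarrow> complex^'n \<Rightarrow> complex^'n" where
  "act B f x = fold_coeffs (\<lambda>a y. a *s x + B *v y) f 0"

lemma act_0 [simp]: "act B 0 x = 0"
  by (simp add: act_def)

lemma act_pCons: "act B (pCons a f) x = a *s x + B *v act B f x"
  by (cases "a = 0 \<and> f = 0") (auto simp: act_def)

lemma act_1 [simp]: "act B 1 x = x"
  by (simp add: one_pCons act_pCons)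

lemma act_zero_right [simp]: "act B f 0 = 0"
  by (induction f) (auto simp: act_pCons)

lemma act_add: "act B (f + g) x = act B f x + act B g x"
proof (induction f arbitrary: g)
  case (pCons a f)
  show ?case
    by (cases g) (simp add: act_pCons pCons.IH vec.add vec.scale_left_distrib)
qed simp

lemma act_smult: "act B (smult c f) x = c *s act B f x"
  by (induction f) (simp_all add: act_pCons vec.scale_right_distrib vec.scale)

lemma act_diff: "act B (f - g) x = act B f x - act B g x"
  using act_add[of B "f - g" g x] by simp

lemma act_sum: "act B (\<Sum>i\<in>I. f i) x = (\<Sum>i\<in>I. act B (f i) x)"
  by (induction I rule: infinite_finite_induct) (simp_all add: act_add)

lemma act_add_right: "act B f (x + y) = act B f x + act B f y"
  by (induction f) (simp_all add: act_pCons vec.add vec.scale_right_distrib)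

lemma act_scale_right: "act B f (c *s x) = c *s act B f x"
  by (induction f) (simp_all add: act_pCons vec.scale vec.scale_right_distrib mult.commute)

lemma act_mult: "act B (f * g) x = act B f (act B g x)"
  by (induction f) (simp_all add: act_pCons act_add act_smult)

lemma act_mult_commute: "act B f (act B g x) = act B g (act B f x)"
  by (metis act_mult mult.commute)

lemma act_linear_factor: "act B [:- w, 1:] x = B *v x - w *s x"
  by (simp add: act_pCons vec.scale_minus_left)

lemma act_eigenvector: "B *v x = w *s x \<Longrightarrow> act B f x = poly f w *s x"
  by (induction f) (simp_all add: act_pCons vec.scale vec.scale_left_distrib mult.commute)

lemma act_monom_Suc: "act B (monom 1 (Suc i)) x = B *v act B (monom 1 i) x"
  by (simp add: monom_Suc act_pCons)

lemma act_eq_sum: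
  assumes "degree f < d"
  shows "act B f x = (\<Sum>i<d. coeff f i *s act B (monom 1 i) x)"
proof -
  have "f = (\<Sum>i<d. monom (coeff f i) i)"
    using assms poly_as_sum_of_monoms'[of f "d - 1"] by (simp add: lessThan_Suc_atMost[symmetric])
  also have "\<dots> = (\<Sum>i<d. smult (coeff f i) (monom 1 i))"
    by (simp add: smult_monom)
  finally have "act B f x = act B \<dots> x" by simp
  thus ?thesis by (simp add: act_sum act_smult)
qed

lemma act_Bezout:
  assumes "coprime f g"
  obtains a b where "\<And>x. x = act B f (act B a x) + act B g (act B b x)"
proof -
  obtain a b where "bezout_coefficients f g = (a, b)" by (cases "bezout_coefficients f g") auto
  hence "f * a + g * b = 1"
    using assms bezout_coefficients[of f g a b] by (simp add: mult.commute)
  hence "x = act B f (act B a x) + act B g (act B b x)" for x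
    by (metis act_1 act_add act_mult)
  thus ?thesis by (rule that)
qed

definition cyc :: "complex^'n^'n \<Rightarrow> complex^'n \<Rightarrow> (complex^'n) set" where
  "cyc B z = range (\<lambda>f. act B f z)"

text \<open>\<open>q\<close> generates the ideal of polynomials annihilating \<open>z\<close>: the
  local minimal polynomial of \<open>z\<close>, up to a unit factor.\<close>

definition local_ann :: "complex^'n^'n \<Rightarrow> complex^'n \<Rightarrow> complex poly \<Rightarrow> bool" where
  "local_ann B z q \<longleftrightarrow> (\<forall>f. act B f z = 0 \<longleftrightarrow> q dvd f)"

lemma local_annD: "local_ann B z q \<Longrightarrow> act B f z = 0 \<longleftrightarrow> q dvd f"
  by (simp add: local_ann_def)

lemma act_in_cyc [simp]: "act B f z \<in> cyc B z"
  by (simp add: cyc_def)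

lemma cycE:
  assumes "x \<in> cyc B z"
  obtains f where "x = act B f z"
  using assms by (auto simp: cyc_def)

lemma subspace_cyc: "vec.subspace (cyc B z)"
  unfolding vec.subspace_def
  by (metis act_0 act_add act_in_cyc act_smult cycE)

lemma act_mem_cyc: "x \<in> cyc B z \<Longrightarrow> act B f x \<in> cyc B z"
  by (metis act_in_cyc act_mult cycE)

lemma act_mod:
  assumes "act B q z = 0"
  shows "act B (f mod q) z = act B f z"
proof -
  have "act B f z = act B (f div q * q + f mod q) z" by simp
  also have "\<dots> = act B (f mod q) z" using assms by (simp only: act_add act_mult act_zero_right) simp
  finally show ?thesis by simp
qed

lemma local_ann_act:
  assumes "local_ann B z (r * q)" "r \<noteq> 0"
  shows "local_ann B (act B r z) q"
  using assms by (auto simp: local_ann_def act_mult[symmetric] mult.commute)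

text \<open>A linear relation among the \<open>B^i z\<close> with \<open>i < d\<close> is a
  polynomial of degree below \<open>d\<close> that annihilates \<open>z\<close>.\<close>

lemma act_monom_independent:
  fixes z :: "complex^'n::finite"
  assumes "\<And>f. act B f z = 0 \<Longrightarrow> degree f < d \<Longrightarrow> f = 0"
  defines "b \<equiv> \<lambda>i. act B (monom 1 i) z"
  shows "inj_on b {..<d}" "vec.independent (b ` {..<d})"
proof -
  show inj: "inj_on b {..<d}"
  proof (rule inj_onI)
    fix i j assume ij: "i \<in> {..<d}" "j \<in> {..<d}" "b i = b j"
    have "act B (monom 1 i - monom 1 j) z = 0"
      using ij by (simp add: b_def act_diff)
    moreover have "degree (monom 1 i - monom (1::complex) j) < d"
      using ij by (intro degree_diff_less) (auto simp: degree_monom_eq)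
    ultimately have "monom 1 i - monom (1::complex) j = 0" by (rule assms)
    thus "i = j" by (metis coeff_monom eq_iff_diff_eq_0 one_neq_zero)
  qed
  show "vec.independent (b ` {..<d})"
  proof (rule vec.independent_if_scalars_zero)
    fix f x assume 0: "(\<Sum>x\<in>b ` {..<d}. f x *s x) = 0" and x: "x \<in> b ` {..<d}"
    define g where "g = (\<Sum>i<d. monom (f (b i)) i)"
    have "act B g z = (\<Sum>i<d. f (b i) *s b i)"
      unfolding g_def act_sum b_def by (simp add: act_smult[symmetric] smult_monom)
    also have "\<dots> = 0"
      using 0 by (simp add: sum.reindex[OF inj])
    finally have "act B g z = 0" .
    moreover obtain i where i: "i < d" "x = b i" using x by auto
    have "degree g < d"
      unfolding g_def using i by (intro degree_sum_less) (auto intro: le_less_trans[OF degree_monom_le])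
    ultimately have "g = 0" by (rule assms)
    moreover have "coeff g i = f x"
      using i by (simp add: g_def coeff_sum sum.delta)
    ultimately show "f x = 0" by simp
  qed simp
qed

lemma local_ann_small:
  assumes "local_ann B z q" "act B f z = 0" "degree f < degree q"
  shows "f = 0"
  using assms by (metis dvd_imp_degree_le leD local_annD)

lemma span_act_monom:
  fixes z :: "complex^'n::finite"
  assumes "local_ann B z q" "q \<noteq> 0"
  defines "b \<equiv> \<lambda>i. act B (monom 1 i) z"
  shows "vec.span (b ` {..<degree q}) = cyc B z"
proof (rule subset_antisym)
  show "vec.span (b ` {..<degree q}) \<subseteq> cyc B z"
    by (intro vec.span_minimal subspace_cyc) (auto simp: b_def)
  show "cyc B z \<subseteq> vec.span (b ` {..<degree q})"
  proof
    fix x assume "x \<in> cyc B z"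
    then obtain f where "x = act B f z" by (rule cycE)
    hence x: "x = act B (f mod q) z"
      using act_mod[of B q z f] assms(1) by (simp add: local_annD)
    show "x \<in> vec.span (b ` {..<degree q})"
    proof (cases "f mod q = 0")
      case False
      hence "degree (f mod q) < degree q" using assms(2) degree_mod_less by blast
      hence "x = (\<Sum>i<degree q. coeff (f mod q) i *s b i)"
        unfolding x b_def by (rule act_eq_sum)
      also have "\<dots> \<in> vec.span (b ` {..<degree q})"
        by (intro vec.span_sum vec.span_scale) (simp add: vec.span_base)
      finally show ?thesis .
    qed (simp add: x vec.span_zero)
  qed
qed

lemma dim_cyc:
  fixes z :: "complex^'n::finite"
  assumes "local_ann B z q" "q \<noteq> 0"
  shows "vec.dim (cyc B z) = degree q"
proof -
  let ?b = "\<lambda>i. act B (monom 1 i) z"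
  have "inj_on ?b {..<degree q}" "vec.independent (?b ` {..<degree q})"
    using act_monom_independent local_ann_small[OF assms(1)] by blast+
  moreover have "vec.dim (cyc B z) = vec.dim (?b ` {..<degree q})"
    unfolding span_act_monom[OF assms, symmetric] by (rule vec.dim_span)
  ultimately show ?thesis
    by (simp add: vec.dim_eq_card_independent card_image)
qed

section \<open>Generalised eigenspaces and cyclic subspaces\<close>

definition gker :: "complex^'n^'n \<Rightarrow> complex \<Rightarrow> nat \<Rightarrow> (complex^'n) set" where
  "gker B w k = {x. act B ([:- w, 1:] ^ k) x = 0}"

definition geig :: "complex^'n^'n \<Rightarrow> complex \<Rightarrow> (complex^'n) set" where
  "geig B w = (\<Union>k. gker B w k)"

lemma subspace_gker: "vec.subspace (gker B w k)"
  by (simp add: gker_def vec.subspace_def act_add_right act_scale_right)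

lemma gker_mono:
  assumes "j \<le> k"
  shows "gker B w j \<subseteq> gker B w k"
proof
  fix x assume "x \<in> gker B w j"
  hence "act B ([:- w, 1:] ^ (k - j) * [:- w, 1:] ^ j) x = 0"
    by (simp only: act_mult gker_def mem_Collect_eq) simp
  thus "x \<in> gker B w k" using assms by (simp add: gker_def flip: power_add)
qed

lemma subspace_geig: "vec.subspace (geig B w)"
  unfolding vec.subspace_def
proof (intro conjI ballI allI)
  show "0 \<in> geig B w"
    using vec.subspace_0[OF subspace_gker] unfolding geig_def by blast
next
  fix x y assume "x \<in> geig B w" "y \<in> geig B w"
  then obtain j k where "x \<in> gker B w j" "y \<in> gker B w k" unfolding geig_def by blast
  hence "x \<in> gker B w (max j k)" "y \<in> gker B w (max j k)"
    using gker_mono by (meson max.cobounded1 max.cobounded2 subsetD)+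
  hence "x + y \<in> gker B w (max j k)" by (rule vec.subspace_add[OF subspace_gker])
  thus "x + y \<in> geig B w" unfolding geig_def by blast
next
  fix c x assume "x \<in> geig B w"
  thus "c *s x \<in> geig B w"
    unfolding geig_def using vec.subspace_scale[OF subspace_gker] by blast
qed

lemma order_decomp_coprime:
  fixes q :: "complex poly"
  assumes "q \<noteq> 0"
  obtains r where "q = [:- w, 1:] ^ order w q * r" "poly r w \<noteq> 0" "r \<noteq> 0"
    "\<And>k. coprime ([:- w, 1:] ^ k) r"
proof -
  from order_decomp[OF assms, of w] obtain r where
    r: "q = [:- w, 1:] ^ order w q * r" "\<not> [:- w, 1:] dvd r" by auto
  have "prime_elem [:- w, 1:]" by (simp add: prime_elem_iff_irreducible irreducible_linear_field_poly)
  hence "coprime [:- w, 1:] r"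
    using r(2) prime_elem_imp_coprime by blast
  hence "coprime ([:- w, 1:] ^ k) r" for k by simp
  with r show ?thesis using that assms by (metis mult_zero_right poly_eq_0_iff_dvd)
qed

text \<open>Write \<open>q = (X - w)^k r\<close> with \<open>r\<close> coprime to
  \<open>X - w\<close>. The intersection is the cyclic subspace of \<open>r(B) z\<close>, whose
  annihilator is \<open>(X - w)^k\<close>.\<close>

lemma dim_cyc_geig:
  fixes z :: "complex^'n::finite"
  assumes "local_ann B z q" "q \<noteq> 0"
  shows "vec.dim (cyc B z \<inter> geig B w) = order w q"
proof -
  obtain r where r: "q = [:- w, 1:] ^ order w q * r" "r \<noteq> 0" "\<And>k. coprime ([:- w, 1:] ^ k) r"
    using order_decomp_coprime[OF assms(2)] by metis
  have la: "local_ann B (act B r z) ([:- w, 1:] ^ order w q)"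
    using assms(1) r by (intro local_ann_act) (simp_all add: mult.commute)
  have "cyc B z \<inter> geig B w = cyc B (act B r z)"
  proof (intro equalityI subsetI)
    fix x assume x: "x \<in> cyc B z \<inter> geig B w"
    then obtain f where f: "x = act B f z" by (auto elim: cycE)
    obtain k where "x \<in> gker B w k" using x by (auto simp: geig_def)
    hence "act B ([:- w, 1:] ^ k * f) z = 0" by (simp add: f gker_def act_mult)
    hence "q dvd [:- w, 1:] ^ k * f" using assms(1) by (simp add: local_annD)
    hence "r dvd [:- w, 1:] ^ k * f" by (metis r(1) dvd_mult_right)
    hence "r dvd f" using r(3)[of k] by (metis coprime_commute coprime_dvd_mult_right_iff)
    then obtain g where "f = g * r" by (metis dvdE mult.commute)
    thus "x \<in> cyc B (act B r z)" by (simp add: f act_mult)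
  next
    fix x assume "x \<in> cyc B (act B r z)"
    then obtain f where f: "x = act B f (act B r z)" by (rule cycE)
    have "act B ([:- w, 1:] ^ order w q) x = 0"
      by (metis f act_mult_commute act_zero_right local_annD[OF la] dvd_refl)
    thus "x \<in> cyc B z \<inter> geig B w"
      by (auto simp: f act_mem_cyc geig_def gker_def)
  qed
  thus ?thesis using dim_cyc[OF la] by (simp add: degree_linear_power)
qed

lemma act_diff_right: "act B f (x - y) = act B f x - act B f y"
  using act_add_right[of B f "x - y" y] by simp

lemma act_sum_right: "act B f (\<Sum>i\<in>I. x i) = (\<Sum>i\<in>I. act B f (x i))"
  by (induction I rule: infinite_finite_induct) (simp_all add: act_add_right)

lemma linear_act: "Vector_Spaces.linear (*s) (*s) (act B f)"
  by unfold_locales (simp_all add: act_add_right act_scale_right)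

text \<open>Each Horner step adds to the difference a value of \<open>C - B\<close> and applies
  \<open>B\<close> to the previous difference; both stay in the \<open>B\<close>-invariant
  subspace.\<close>

lemma act_cong_mod_cyc:
  assumes "\<And>x. C *v x - B *v x \<in> cyc B z"
  shows "act C f x - act B f x \<in> cyc B z"
proof (induction f)
  case (pCons a f)
  have "act C (pCons a f) x - act B (pCons a f) x =
      (C *v act C f x - B *v act C f x) + (act B [:0, 1:] (act C f x - act B f x))"
    by (simp add: act_pCons vec.diff)
  also have "\<dots> \<in> cyc B z"
    by (intro vec.subspace_add[OF subspace_cyc] assms act_mem_cyc pCons.IH)
  finally show ?case .
qed (simp add: vec.subspace_0[OF subspace_cyc])

text \<open>
  The generalised eigenvectors of the map induced on the quotient by \<open>cyc B z\<close>,
  pulled back to the whole space.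
\<close>

lemma cyc_plus_geig:
  assumes "local_ann B z q" "q \<noteq> 0"
  shows "{x. \<exists>N. act B ([:- w, 1:] ^ N) x \<in> cyc B z} = {x + y | x y. x \<in> cyc B z \<and> y \<in> geig B w}"
    (is "?L = ?R")
proof (intro equalityI subsetI)
  fix x assume "x \<in> ?L"
  then obtain N where N: "act B ([:- w, 1:] ^ N) x \<in> cyc B z" by auto
  obtain r where r: "q = [:- w, 1:] ^ order w q * r" "\<And>k. coprime ([:- w, 1:] ^ k) r"
    using order_decomp_coprime[OF assms(2)] by metis
  \<comment> \<open>In this splitting of \<open>x\<close> the first summand is a polynomial in
    \<open>B\<close> applied to \<open>(B - w)^N x\<close>, hence in \<open>cyc B z\<close>; the
    second is killed by a power of \<open>B - w\<close>, since \<open>q\<close> annihilates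
    \<open>(B - w)^N x = f(B) z\<close>.\<close>
  obtain a b where ab: "\<And>x. x = act B ([:- w, 1:] ^ N) (act B a x) + act B r (act B b x)"
    using act_Bezout[OF r(2)] by blast
  obtain f where f: "act B ([:- w, 1:] ^ N) x = act B f z" using N by (rule cycE)
  have "act B ([:- w, 1:] ^ N) (act B a x) \<in> cyc B z"
    by (subst act_mult_commute) (intro act_mem_cyc N)
  moreover have "act B ([:- w, 1:] ^ (order w q + N)) (act B r (act B b x)) = 0"
  proof -
    have "act B ([:- w, 1:] ^ (order w q + N)) (act B r (act B b x)) =
        act B ([:- w, 1:] ^ (order w q + N) * (r * b)) x"
      by (simp add: act_mult)
    also have "[:- w, 1:] ^ (order w q + N) * (r * b) = b * q * [:- w, 1:] ^ N"
      by (subst (2) r(1)) (simp add: power_add mult_ac)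
    also have "act B \<dots> x = act B (b * f * q) z"
      unfolding act_mult f by (simp only: act_mult_commute[of B q])
    also have "\<dots> = 0" by (simp add: local_annD[OF assms(1)])
    finally show ?thesis .
  qed
  hence "act B r (act B b x) \<in> geig B w" unfolding geig_def gker_def by blast
  ultimately show "x \<in> ?R" using ab[of x] by blast
next
  fix x assume "x \<in> ?R"
  then obtain y v N where "x = y + v" "y \<in> cyc B z" "act B ([:- w, 1:] ^ N) v = 0"
    by (auto simp: geig_def gker_def)
  thus "x \<in> ?L" by (auto simp: act_add_right intro!: exI[of _ N] act_mem_cyc)
qed

text \<open>
  Perturbing \<open>B\<close> by something with values in the invariant subspace \<open>cyc B z\<close> does not
  change the map induced on the quotient, so only the part on \<open>cyc B z\<close> matters.
\<close>

lemma dim_geig_swap: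
  fixes z :: "complex^'n::finite"
  assumes B: "local_ann B z q" "q \<noteq> 0" and C: "local_ann C z p" "p \<noteq> 0"
    and cyc: "cyc C z = cyc B z" and diff: "\<And>x. C *v x - B *v x \<in> cyc B z"
  shows "vec.dim (geig C w) + order w q = vec.dim (geig B w) + order w p"
proof -
  have "act C f x \<in> cyc B z \<longleftrightarrow> act B f x \<in> cyc B z" for f x
  proof -
    have "act C f x - act B f x \<in> cyc B z" using diff by (rule act_cong_mod_cyc)
    thus ?thesis
      using vec.subspace_add[OF subspace_cyc, of "act C f x - act B f x" B z "act B f x"]
        vec.subspace_diff[OF subspace_cyc, of "act C f x" B z "act C f x - act B f x"] by auto
  qed
  hence "{x + y | x y. x \<in> cyc C z \<and> y \<in> geig C w} = {x + y | x y. x \<in> cyc B z \<and> y \<in> geig B w}"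
    using cyc_plus_geig[OF B, of w] cyc_plus_geig[OF C, of w] cyc by simp
  \<comment> \<open>The sums \<open>cyc + geig\<close> coincide for \<open>B\<close> and
    \<open>C\<close>, so the dimension formula compares the two intersections, of dimensions
    \<open>order w q\<close> and \<open>order w p\<close>.\<close>
  thus ?thesis
    using vec.dim_sums_Int[OF subspace_cyc[of B z] subspace_geig[of B w]]
      vec.dim_sums_Int[OF subspace_cyc[of C z] subspace_geig[of C w]]
      dim_cyc_geig[OF B, of w] dim_cyc_geig[OF C, of w] cyc by simp
qed

subsection \<open>Minimal polynomials\<close>

definition min_poly :: "complex^'n^'n \<Rightarrow> complex poly \<Rightarrow> bool" where
  "min_poly B m \<longleftrightarrow> lead_coeff m = 1 \<and> (\<forall>f. (\<forall>x. act B f x = 0) \<longleftrightarrow> m dvd f)"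

lemma min_polyD:
  assumes "min_poly B m"
  shows "lead_coeff m = 1" "m \<noteq> 0" "act B m x = 0"
    "(\<And>x. act B f x = 0) \<Longrightarrow> m dvd f"
  using assms by (auto simp: min_poly_def)

text \<open>Counting dimensions gives every single vector a nonzero annihilating polynomial; the
  product of those of the standard basis vectors annihilates the whole space.\<close>

lemma ex_act_eq_0:
  fixes B :: "complex^'n^'n::finite"
  shows "\<exists>f. f \<noteq> 0 \<and> (\<forall>x. act B f x = 0)"
proof -
  have ex1: "\<exists>f. f \<noteq> 0 \<and> act B f x = 0" for x
  proof (rule ccontr)
    assume *: "\<nexists>f. f \<noteq> 0 \<and> act B f x = 0"
    let ?b = "\<lambda>i. act B (monom 1 i) x"
    have "inj_on ?b {..<Suc CARD('n)}" "vec.independent (?b ` {..<Suc CARD('n)})"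
      using act_monom_independent[of B x "Suc CARD('n)"] * by blast+
    hence "card (?b ` {..<Suc CARD('n)}) \<le> vec.dim (?b ` {..<Suc CARD('n)})"
      by (simp add: vec.independent_bound_general)
    also have "\<dots> \<le> CARD('n)" using vec.dim_subset_UNIV by (simp add: vec.dimension_def card_cart_basis)
    finally show False using \<open>inj_on ?b _\<close> by (simp add: card_image)
  qed
  then obtain F where F: "\<And>x. F x \<noteq> 0" "\<And>x. act B (F x) x = 0" by metis
  define f where "f = (\<Prod>i\<in>UNIV. F (axis i 1 :: complex^'n))"
  have "act B f (axis i 1) = 0" for i
  proof -
    have "f = (\<Prod>j\<in>UNIV - {i}. F (axis j 1)) * F (axis i 1)"
      unfolding f_def by (subst prod.remove[of _ i]) auto
    thus ?thesis by (simp add: act_mult F)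
  qed
  hence "act B f (\<Sum>i\<in>UNIV. x $ i *s axis i 1) = 0" for x
    unfolding act_sum_right act_scale_right by simp
  hence "act B f x = 0" for x by (simp add: basis_expansion)
  moreover have "f \<noteq> 0" by (simp add: f_def F)
  ultimately show ?thesis by blast
qed

lemma ex_min_poly:
  fixes B :: "complex^'n^'n::finite"
  obtains m where "min_poly B m"
proof -
  define S where "S f \<longleftrightarrow> f \<noteq> 0 \<and> (\<forall>x. act B f x = 0)" for f
  obtain f where f: "S f" "\<And>g. S g \<Longrightarrow> degree f \<le> degree g"
    using ex_has_least_nat[of S _ degree] ex_act_eq_0[of B] unfolding S_def by metis
  define m where "m = smult (inverse (lead_coeff f)) f"
  have m: "lead_coeff m = 1" "\<And>x. act B m x = 0" "m \<noteq> 0" "degree m = degree f"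
    using f(1) by (simp_all add: m_def S_def act_smult)
  have "m dvd g" if "\<And>x. act B g x = 0" for g
  proof (rule ccontr)
    assume "\<not> m dvd g"
    hence "g mod m \<noteq> 0" by (simp add: mod_eq_0_iff_dvd)
    moreover have "act B (g mod m) x = 0" for x
      using act_mod[OF m(2), of g] that by simp
    ultimately have "degree f \<le> degree (g mod m)" by (intro f(2)) (simp add: S_def)
    thus False using degree_mod_less[OF \<open>m \<noteq> 0\<close>, of g] \<open>g mod m \<noteq> 0\<close> m(4) by simp
  qed
  moreover have "act B g x = 0" if "m dvd g" for g x
    using that by (auto simp: act_mult mult.commute[of m] m(2) elim!: dvdE)
  ultimately have "min_poly B m" using m(1) unfolding min_poly_def by blast
  thus ?thesis by (rule that)
qed

text \<open>Only the maximal proper divisors of \<open>q\<close> need testing. With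
  \<open>f\<close>, also \<open>gcd f q\<close> annihilates \<open>z\<close>; if its cofactor
  \<open>h\<close> in \<open>q\<close> were not a unit, \<open>h\<close> would have a complex root
  \<open>w\<close>, and \<open>gcd f q\<close> would divide \<open>q / (X - w)\<close>.\<close>

lemma local_annI_roots:
  assumes "q \<noteq> 0" "act B q z = 0"
    and "\<And>w g. q = [:- w, 1:] * g \<Longrightarrow> act B g z \<noteq> 0"
  shows "local_ann B z q"
  unfolding local_ann_def
proof (intro allI iffI)
  fix f assume f: "act B f z = 0"
  obtain a b where "bezout_coefficients f q = (a, b)" by (cases "bezout_coefficients f q") auto
  hence "a * f + b * q = gcd f q"
    using bezout_coefficients[of f q a b] by (simp add: mult.commute)
  hence gcd0: "act B (gcd f q) z = 0"
    by (metis act_add act_mult act_zero_right add.right_neutral f assms(2))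
  obtain h where h: "q = gcd f q * h" by (metis dvdE gcd_dvd2)
  have "is_unit h"
  proof (rule ccontr)
    assume "\<not> is_unit h"
    moreover have "h \<noteq> 0" using h assms(1) by auto
    ultimately have "degree h \<noteq> 0" by (simp add: is_unit_iff_degree)
    then obtain w where "poly h w = 0"
      using fundamental_theorem_of_algebra_alt[of h] by (metis degree_pCons_0)
    then obtain h' where "h = [:- w, 1:] * h'" by (auto simp: poly_eq_0_iff_dvd)
    hence "gcd f q * h = [:- w, 1:] * (h' * gcd f q)" by (simp only: mult_ac)
    hence "act B (h' * gcd f q) z \<noteq> 0" by (rule assms(3)[OF trans[OF h]])
    thus False by (simp add: act_mult gcd0)
  qed
  hence "gcd f q * h dvd gcd f q" by (simp add: mult_unit_dvd_iff)
  hence "q dvd gcd f q" by (rule ssubst[OF h, where P = "\<lambda>x. x dvd gcd f q"])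
  thus "q dvd f" by simp
next
  fix f assume "q dvd f"
  thus "act B f z = 0" using assms(2) by (auto simp: act_mult mult.commute[of q] elim!: dvdE)
qed

section \<open>Real vectors whose local minimal polynomial is the minimal polynomial\<close>

definition real_vec :: "complex^'n \<Rightarrow> bool" where
  "real_vec x \<longleftrightarrow> (\<forall>i. x $ i \<in> \<real>)"

text \<open>
  A point on the moment curve works, because on it each of the maps becomes a nonzero
  polynomial in the curve parameter.
\<close>

lemma ex_real_vec_linear_nonzero:
  fixes F :: "'i \<Rightarrow> complex^'n::finite \<Rightarrow> complex^'n"
  assumes "finite I" and lin: "\<And>w. w \<in> I \<Longrightarrow> Vector_Spaces.linear (*s) (*s) (F w)"
    and "\<And>w. w \<in> I \<Longrightarrow> \<exists>x. F w x \<noteq> 0"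
  shows "\<exists>z. real_vec z \<and> (\<forall>w\<in>I. F w z \<noteq> 0)"
proof -
  \<comment> \<open>Distinct exponents for distinct coordinates keep the terms of
    \<open>F w (zz t)\<close>, as a polynomial in \<open>t\<close>, from cancelling.\<close>
  obtain k :: "'n \<Rightarrow> nat" where k: "inj k"
    using finite_imp_inj_to_nat_seg[OF finite_class.finite_UNIV[where 'a = 'n]] by auto
  define zz :: "complex \<Rightarrow> complex^'n" where "zz t = (\<chi> i. t ^ k i)" for t
  have "\<exists>h. h \<noteq> 0 \<and> (\<forall>t. poly h t \<noteq> 0 \<longrightarrow> F w (zz t) \<noteq> 0)" if w: "w \<in> I" for w
  proof -
    interpret Vector_Spaces.linear "(*s)" "(*s)" "F w" by (rule lin[OF w])
    have expand: "F w x = (\<Sum>i\<in>UNIV. x $ i *s F w (axis i 1))" for x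
      by (subst basis_expansion[symmetric]) (simp only: sum scale)
    obtain x where "F w x \<noteq> 0" using assms(3)[OF w] by blast
    hence "(\<Sum>i\<in>UNIV. x $ i *s F w (axis i 1)) \<noteq> 0" using expand[of x] by simp
    then obtain i where "x $ i *s F w (axis i 1) \<noteq> 0" by (meson sum.neutral)
    hence "F w (axis i 1) \<noteq> 0" by auto
    then obtain j where ij: "F w (axis i 1) $ j \<noteq> 0" by (auto simp: vec_eq_iff)
    define h where "h = (\<Sum>i\<in>UNIV. monom (F w (axis i 1) $ j) (k i))"
    have "coeff h (k i) = F w (axis i 1) $ j"
      using k by (simp add: h_def coeff_sum sum.delta inj_eq)
    hence "h \<noteq> 0" using ij by auto
    moreover have "F w (zz t) $ j = poly h t" for t
      by (subst expand) (simp add: zz_def h_def poly_sum poly_monom mult.commute)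
    ultimately show ?thesis by (metis zero_index)
  qed
  then obtain h where h: "\<And>w. w \<in> I \<Longrightarrow> h w \<noteq> 0"
    "\<And>w t. w \<in> I \<Longrightarrow> poly (h w) t \<noteq> 0 \<Longrightarrow> F w (zz t) \<noteq> 0" by metis
  define H where "H = (\<Prod>w\<in>I. h w)"
  have "H \<noteq> 0" using h(1) assms(1) by (simp add: H_def)
  hence "finite {t. poly H t = 0}" by (rule poly_roots_finite)
  moreover have "infinite (range complex_of_real)"
    by (simp add: finite_image_iff inj_of_real infinite_UNIV_char_0)
  ultimately obtain t where "poly H (complex_of_real t) \<noteq> 0"
    by (metis (mono_tags, lifting) finite_subset image_subset_iff mem_Collect_eq)
  hence "poly (h w) (of_real t) \<noteq> 0" if "w \<in> I" for w
    using that assms(1) by (auto simp: H_def poly_prod)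
  moreover have "real_vec (zz (of_real t))"
    by (simp add: real_vec_def zz_def)
  ultimately show ?thesis using h(2) by blast
qed

text \<open>By minimality \<open>m / (X - w)\<close> gives a nonzero map for every root
  \<open>w\<close> of \<open>m\<close>. A vector outside all these kernels passes the test on
  divisors, and it can be real even if \<open>B\<close> is not.\<close>

lemma ex_real_cyclic_vector:
  fixes B :: "complex^'n^'n::finite"
  assumes m: "min_poly B m"
  obtains z where "real_vec z" "local_ann B z m"
proof -
  define I where "I = {w. poly m w = 0}"
  have fin: "finite I" unfolding I_def by (rule poly_roots_finite[OF min_polyD(2)[OF m]])
  have div: "g = m div [:- w, 1:]" if "m = [:- w, 1:] * g" for w g
    unfolding that by (rule nonzero_mult_div_cancel_left[symmetric]) simp
  have ex: "\<exists>x. act B (m div [:- w, 1:]) x \<noteq> 0" if w: "w \<in> I" for w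
  proof (rule ccontr)
    assume "\<nexists>x. act B (m div [:- w, 1:]) x \<noteq> 0"
    hence dvd: "m dvd m div [:- w, 1:]" by (intro min_polyD(4)[OF m]) auto
    have "[:- w, 1:] dvd m" using w by (simp add: I_def poly_eq_0_iff_dvd)
    then obtain g where g: "m = [:- w, 1:] * g" by (rule dvdE)
    have "g \<noteq> 0" using g min_polyD(2)[OF m] by auto
    hence "degree m \<le> degree g" using dvd div[OF g] by (metis dvd_imp_degree_le)
    moreover have "degree m = Suc (degree g)"
      unfolding g using \<open>g \<noteq> 0\<close> by (subst degree_mult_eq) simp_all
    ultimately show False by simp
  qed
  obtain z where z: "real_vec z" "\<And>w. w \<in> I \<Longrightarrow> act B (m div [:- w, 1:]) z \<noteq> 0"
    using ex_real_vec_linear_nonzero[where F = "\<lambda>w. act B (m div [:- w, 1:])", OF fin linear_act ex]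
    by blast
  have "local_ann B z m"
  proof (rule local_annI_roots)
    fix w g assume g: "m = [:- w, 1:] * g"
    hence "poly m w = 0" by simp
    thus "act B g z \<noteq> 0" using z(2)[of w] div[OF g] by (simp add: I_def)
  qed (use min_polyD[OF m] in auto)
  thus ?thesis using that z(1) by blast
qed

section \<open>Orders of the roots of the minimal polynomial\<close>

lemma degree_eq_sum_order:
  fixes p :: "complex poly"
  assumes "p \<noteq> 0"
  shows "degree p = (\<Sum>w | poly p w = 0. order w p)"
proof -
  have "degree p = degree (\<Prod>w | poly p w = 0. [:- w, 1:] ^ order w p)"
    using assms by (subst (1) complex_poly_decompose[symmetric]) simp
  also have "\<dots> = (\<Sum>w | poly p w = 0. order w p)"
    by (subst degree_prod_eq_sum_degree) (simp_all add: degree_linear_power)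
  finally show ?thesis .
qed

lemma degree_min_poly:
  fixes B :: "complex^'n^'n::finite"
  assumes m: "min_poly B m"
  shows "degree m \<noteq> 0"
proof
  assume "degree m = 0"
  then obtain c where "m = [:c:]" by (rule degree_eq_zeroE)
  hence "m = 1" using min_polyD(1)[OF m] by (simp add: one_pCons)
  hence "axis undefined 1 = (0 :: complex^'n)"
    using min_polyD(3)[OF m, of "axis undefined 1"] by simp
  thus False by (simp add: axis_eq_0_iff)
qed

text \<open>Let \<open>r\<close> be the cofactor of the full power of \<open>X - w\<close> in
  \<open>m\<close>. By Bezout, a vector killed by some power of \<open>B - w\<close> has the form
  \<open>r(B) y\<close>, so the power of exponent \<open>order w m\<close> maps it to
  \<open>m(B) y = 0\<close>.\<close>

lemma geig_eq_gker:
  assumes m: "min_poly B m" and k: "order w m \<le> k"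
  shows "geig B w = gker B w k"
proof -
  obtain r where r: "m = [:- w, 1:] ^ order w m * r" "\<And>k. coprime ([:- w, 1:] ^ k) r"
    using order_decomp_coprime[OF min_polyD(2)[OF m]] by metis
  have "gker B w N \<subseteq> gker B w (order w m)" for N
  proof
    fix x assume "x \<in> gker B w N"
    hence x: "act B ([:- w, 1:] ^ N) x = 0" by (simp add: gker_def)
    obtain a b where ab: "\<And>x. x = act B ([:- w, 1:] ^ N) (act B a x) + act B r (act B b x)"
      using act_Bezout[OF r(2)] by blast
    define y where "y = act B b x"
    have "x = act B r y"
      using ab[of x] x by (simp add: act_mult_commute[of B _ a] y_def)
    hence "act B ([:- w, 1:] ^ order w m) x = act B ([:- w, 1:] ^ order w m * r) y"
      by (simp add: act_mult)
    also have "\<dots> = act B m y" by (simp only: r(1)[symmetric])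
    finally have "act B ([:- w, 1:] ^ order w m) x = act B m y" .
    thus "x \<in> gker B w (order w m)" by (simp add: gker_def min_polyD(3)[OF m])
  qed
  thus ?thesis using gker_mono[OF k] unfolding geig_def by blast
qed

text \<open>Beyond the order the kernels are already stationary at \<open>L - 1\<close>. Up to it,
  with \<open>k\<close> the order, minimality gives \<open>y\<close> not annihilated by
  \<open>(X - w)^(k-1) r\<close>, and \<open>(B - w)^(k-L) r(B) y\<close> lies in the
  \<open>L\<close>-th kernel but not in the one before.\<close>

lemma gker_psubset_iff:
  assumes m: "min_poly B m" and "L \<ge> 1"
  shows "(\<exists>x. x \<in> gker B w L \<and> x \<notin> gker B w (L - 1)) \<longleftrightarrow> L \<le> order w m"
proof
  assume "\<exists>x. x \<in> gker B w L \<and> x \<notin> gker B w (L - 1)"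
  then obtain x where "x \<in> gker B w L" "x \<notin> gker B w (L - 1)" by blast
  show "L \<le> order w m"
  proof (rule ccontr)
    assume "\<not> L \<le> order w m"
    hence "geig B w = gker B w (L - 1)" by (intro geig_eq_gker[OF m]) simp
    thus False using \<open>x \<in> gker B w L\<close> \<open>x \<notin> gker B w (L - 1)\<close> by (auto simp: geig_def)
  qed
next
  assume L: "L \<le> order w m"
  obtain r where r: "m = [:- w, 1:] ^ order w m * r" "r \<noteq> 0"
    using order_decomp_coprime[OF min_polyD(2)[OF m]] by metis
  define k where "k = order w m"
  have k: "L \<le> k" "k \<ge> 1" using L assms(2) by (simp_all add: k_def)
  have mk: "m = [:- w, 1:] ^ k * r" unfolding k_def by (rule r(1))
  have "\<not> m dvd [:- w, 1:] ^ (k - 1) * r"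
  proof
    assume "m dvd [:- w, 1:] ^ (k - 1) * r"
    hence "degree m \<le> degree ([:- w, 1:] ^ (k - 1) * r)"
      using r(2) by (intro dvd_imp_degree_le) auto
    moreover have "degree m = k + degree r" "degree ([:- w, 1:] ^ (k - 1) * r) = k - 1 + degree r"
      unfolding mk using r(2) by (simp_all add: degree_mult_eq degree_linear_power)
    ultimately show False using k by simp
  qed
  then obtain y where y: "act B ([:- w, 1:] ^ (k - 1) * r) y \<noteq> 0"
    using min_polyD(4)[OF m] by blast
  define x where "x = act B ([:- w, 1:] ^ (k - L) * r) y"
  have "act B ([:- w, 1:] ^ L) x = act B ([:- w, 1:] ^ (L + (k - L)) * r) y"
    by (simp only: x_def power_add mult.assoc act_mult)
  also have "\<dots> = act B m y" using k(1) by (simp add: mk)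
  finally have "x \<in> gker B w L" by (simp add: gker_def min_polyD(3)[OF m])
  moreover have "act B ([:- w, 1:] ^ (L - 1)) x = act B ([:- w, 1:] ^ (L - 1 + (k - L)) * r) y"
    by (simp only: x_def power_add mult.assoc act_mult)
  hence "x \<notin> gker B w (L - 1)" using k(1) y assms(2) by (simp add: gker_def)
  ultimately show "\<exists>x. x \<in> gker B w L \<and> x \<notin> gker B w (L - 1)" by blast
qed

lemma poly_min_poly_eq_0_iff:
  assumes m: "min_poly B m"
  shows "poly m w = 0 \<longleftrightarrow> (\<exists>x. x \<noteq> 0 \<and> B *v x = w *s x)"
proof -
  have "poly m w = 0 \<longleftrightarrow> 1 \<le> order w m"
    using min_polyD(2)[OF m] by (simp add: order_root Suc_le_eq)
  also have "\<dots> \<longleftrightarrow> (\<exists>x. x \<in> gker B w 1 \<and> x \<notin> gker B w 0)"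
    using gker_psubset_iff[OF m, of 1 w] by simp
  finally show ?thesis by (auto simp: gker_def act_linear_factor)
qed

text \<open>If \<open>z\<close> has local minimal polynomial \<open>m\<close>, then
  \<open>cyc B z\<close> meets the eigenspace in a line and \<open>geig B w\<close> in dimension
  \<open>order w m\<close>. So the claim is that either both spaces or neither reach beyond
  \<open>cyc B z\<close>.\<close>

lemma two_le_dim_eigenspace_iff:
  fixes B :: "complex^'n^'n::finite"
  assumes m: "min_poly B m" and "poly m w = 0"
  shows "2 \<le> vec.dim (gker B w 1) \<longleftrightarrow> order w m < vec.dim (geig B w)"
proof -
  obtain z where z: "local_ann B z m" using ex_real_cyclic_vector[OF m] by blast
  note m0 = min_polyD(2)[OF m]
  define k where "k = order w m"
  obtain r where r: "m = [:- w, 1:] ^ k * r" "r \<noteq> 0"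
    using order_decomp_coprime[OF m0] unfolding k_def by metis
  have "k \<ge> 1" using assms(2) m0 by (simp add: k_def order_root Suc_le_eq)
  define g where "g = [:- w, 1:] ^ (k - 1) * r"
  have mg: "m = [:- w, 1:] * g"
    using r \<open>k \<ge> 1\<close> by (simp add: g_def mult.assoc[symmetric] power_Suc[symmetric] del: power_Suc)
  hence "g \<noteq> 0" using m0 by auto
  have la: "local_ann B (act B g z) [:- w, 1:]"
    using z \<open>g \<noteq> 0\<close> unfolding mg by (intro local_ann_act) (simp_all add: mult.commute)
  have "cyc B z \<inter> gker B w 1 = cyc B (act B g z)"
  proof (intro equalityI subsetI)
    fix x assume x: "x \<in> cyc B z \<inter> gker B w 1"
    then obtain f where f: "x = act B f z" by (auto elim: cycE)
    have "act B [:- w, 1:] x = 0" using x by (simp add: gker_def)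
    hence "act B ([:- w, 1:] * f) z = 0" by (simp only: act_mult f)
    hence "[:- w, 1:] * g dvd [:- w, 1:] * f" using local_annD[OF z] mg by metis
    hence "g dvd f" using dvd_mult_cancel_left[of "[:- w, 1:]"] by (metis one_neq_zero pCons_eq_0_iff)
    then obtain h where "f = h * g" by (metis dvdE mult.commute)
    thus "x \<in> cyc B (act B g z)" by (simp add: f act_mult)
  next
    fix x assume "x \<in> cyc B (act B g z)"
    then obtain f where f: "x = act B f (act B g z)" by (rule cycE)
    have "act B [:- w, 1:] x = act B f (act B [:- w, 1:] (act B g z))"
      unfolding f by (rule act_mult_commute)
    also have "act B [:- w, 1:] (act B g z) = 0" using local_annD[OF la, of "[:- w, 1:]"] by simp
    finally show "x \<in> cyc B z \<inter> gker B w 1" by (simp add: gker_def f act_mem_cyc)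
  qed
  hence dim1: "vec.dim (cyc B z \<inter> gker B w 1) = 1" using dim_cyc[OF la] by simp
  have dimk: "vec.dim (cyc B z \<inter> geig B w) = k"
    unfolding k_def by (rule dim_cyc_geig[OF z m0])
  have sub1: "vec.subspace (cyc B z \<inter> gker B w 1)" and subk: "vec.subspace (cyc B z \<inter> geig B w)"
    by (simp_all add: vec.subspace_inter subspace_cyc subspace_gker subspace_geig)
  show ?thesis
  proof
    assume two: "2 \<le> vec.dim (gker B w 1)"
    show "order w m < vec.dim (geig B w)"
    proof (rule ccontr)
      assume "\<not> order w m < vec.dim (geig B w)"
      hence "cyc B z \<inter> geig B w = geig B w"
        using subk subspace_geig dimk by (intro vec.subspace_dim_equal) (auto simp: k_def)
      hence "cyc B z \<inter> gker B w 1 = gker B w 1" by (auto simp: geig_def)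
      thus False using dim1 two by simp
    qed
  next
    assume less: "order w m < vec.dim (geig B w)"
    show "2 \<le> vec.dim (gker B w 1)"
    proof (rule ccontr)
      assume "\<not> 2 \<le> vec.dim (gker B w 1)"
      hence "cyc B z \<inter> gker B w 1 = gker B w 1"
        using sub1 subspace_gker dim1 by (intro vec.subspace_dim_equal) auto
      hence K: "gker B w 1 \<subseteq> cyc B z" by blast
      \<comment> \<open>An eigenspace inside \<open>cyc B z\<close> drags all higher kernels with
        it: if \<open>(B - w) x = f(B) z\<close> and \<open>f = (X - w) h\<close>, then
        \<open>x - h(B) z\<close> is in the eigenspace.\<close>
      have "gker B w j \<subseteq> cyc B z" for j
      proof (induction j)
        case 0
        show ?case using vec.subspace_0[OF subspace_cyc] by (auto simp: gker_def)
      next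
        case (Suc j)
        show ?case
        proof
          fix x assume x: "x \<in> gker B w (Suc j)"
          define y where "y = act B [:- w, 1:] x"
          have "y \<in> gker B w j"
            using x by (simp add: gker_def y_def act_mult[symmetric] mult.commute)
          hence "y \<in> cyc B z" using Suc.IH by blast
          then obtain f where f: "y = act B f z" by (rule cycE)
          \<comment> \<open>The exponent \<open>k\<close> instead of \<open>Suc j\<close> yields
            that \<open>X - w\<close> divides \<open>f\<close>: now \<open>(B - w)^(k-1)\<close>
            kills \<open>f(B) z\<close>, so \<open>m = (X - w)^k r\<close> divides
            \<open>(X - w)^(k-1) f\<close>.\<close>
          have "x \<in> gker B w k"
            using x geig_eq_gker[OF m, of w k] by (auto simp: geig_def k_def)
          moreover have "[:- w, 1:] ^ (k - 1) * [:- w, 1:] = [:- w, 1:] ^ k"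
            using \<open>k \<ge> 1\<close> by (intro power_minus_mult) simp
          ultimately have "act B ([:- w, 1:] ^ (k - 1) * [:- w, 1:]) x = 0"
            by (simp only: gker_def mem_Collect_eq)
          hence "act B ([:- w, 1:] ^ (k - 1) * f) z = 0"
            by (simp only: act_mult f[symmetric] y_def)
          hence "[:- w, 1:] * ([:- w, 1:] ^ (k - 1) * r) dvd [:- w, 1:] ^ (k - 1) * f"
            using local_annD[OF z] mg unfolding g_def by metis
          hence "[:- w, 1:] ^ (k - 1) * ([:- w, 1:] * r) dvd [:- w, 1:] ^ (k - 1) * f"
            by (metis mult.left_commute)
          hence "[:- w, 1:] * r dvd f" by (simp only: dvd_mult_cancel_left) simp
          then obtain h where "f = [:- w, 1:] * h" by (metis dvd_mult_left dvdE)
          hence "act B [:- w, 1:] (x - act B h z) = 0"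
            using f by (simp only: act_diff_right act_mult y_def) simp
          hence "x - act B h z \<in> cyc B z" using K by (auto simp: gker_def)
          thus "x \<in> cyc B z"
            using vec.subspace_add[OF subspace_cyc _ act_in_cyc, of "x - act B h z" B z h] by simp
        qed
      qed
      hence "cyc B z \<inter> geig B w = geig B w" by (auto simp: geig_def)
      thus False using dimk less by (simp add: k_def)
    qed
  qed
qed

subsection \<open>Rank one perturbations of a matrix\<close>

text \<open>Bilinear, without conjugation, so that \<open>dyad u w\<close> is
  \<open>u w^T\<close>.\<close>

definition vdot :: "complex^'n::finite \<Rightarrow> complex^'n \<Rightarrow> complex" where
  "vdot w x = (\<Sum>j\<in>UNIV. w $ j * x $ j)"

definition dyad :: "complex^'n \<Rightarrow> complex^'n \<Rightarrow> complex^'n^'n" where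
  "dyad u w = (\<chi> i j. u $ i * w $ j)"

lemma dyad_mult_vec: "dyad u w *v x = vdot w x *s u"
  by (simp add: dyad_def vdot_def matrix_vector_mult_def vec_eq_iff sum_distrib_left mult_ac)

lemma ex_dual_vector:
  fixes b :: "nat \<Rightarrow> complex^'n::finite"
  assumes "inj_on b {..<d}" "vec.independent (b ` {..<d})"
  obtains w where "\<And>i. i < d \<Longrightarrow> vdot w (b i) = (if i = d - 1 then 1 else 0)"
proof -
  \<comment> \<open>The value \<open>1\<close> is the vector with all entries one, so every row of
    the matrix of the extension \<open>g\<close> represents the functional, and \<open>k\<close> may
    be arbitrary.\<close>
  define f :: "complex^'n \<Rightarrow> complex^'n" where "f x = (if x = b (d - 1) then 1 else 0)" for x
  obtain g where g: "Vector_Spaces.linear (*s) (*s) g" "\<And>x. x \<in> b ` {..<d} \<Longrightarrow> g x = f x"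
    using vec.linear_independent_extend[OF assms(2), of f] by blast
  obtain k :: 'n where True by blast
  define w where "w = matrix g $ k"
  have "vdot w (b i) = (if i = d - 1 then 1 else 0)" if i: "i < d" for i
  proof -
    have "vdot w (b i) = (matrix g *v b i) $ k"
      by (simp add: w_def vdot_def matrix_vector_mult_def)
    also have "\<dots> = f (b i) $ k" using g i by (simp add: matrix_works)
    also have "b i = b (d - 1) \<longleftrightarrow> i = d - 1"
      using inj_on_eq_iff[OF assms(1), of i "d - 1"] i by simp
    hence "f (b i) $ k = (if i = d - 1 then 1 else 0)" by (simp add: f_def)
    finally show ?thesis .
  qed
  thus ?thesis by (rule that)
qed

text \<open>
  The perturbed matrix still maps \<open>B\<^sup>i z\<close> to \<open>B\<^sup>i\<^sup>+\<^sup>1 z\<close> for \<open>i < d - 1\<close>, and the choice of the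
  first factor of the dyad closes this chain with the relation \<open>p\<close>.
\<close>

lemma cyclic_rank_one_placement:
  fixes z :: "complex^'n::finite"
  assumes z: "local_ann B z q" and pq: "degree p = degree q" "lead_coeff p = 1" "q \<noteq> 0"
    and w: "\<And>i. i < degree q \<Longrightarrow> vdot w (act B (monom 1 i) z) = (if i = degree q - 1 then 1 else 0)"
  defines "C \<equiv> B + dyad (- act B p z) w"
  shows "local_ann C z p" "cyc C z = cyc B z" "C *v x - B *v x \<in> cyc B z"
    "degree q \<noteq> 0 \<Longrightarrow> w \<noteq> 0"
proof -
  define d where "d = degree q"
  have p0: "p \<noteq> 0" using pq(2) by auto
  have C: "C *v x = B *v x - vdot w x *s act B p z" for x
    by (simp add: C_def matrix_vector_mult_add_rdistrib dyad_mult_vec vec.scale_minus_right)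
  show "C *v x - B *v x \<in> cyc B z"
    by (simp add: C vec.subspace_neg subspace_cyc act_smult[symmetric])
  have mon: "act C (monom 1 i) z = act B (monom 1 i) z" if "i < d" for i
    using that
  proof (induction i)
    case (Suc i)
    thus ?case using w[of i] by (simp add: act_monom_Suc C d_def)
  qed (simp add: monom_0 one_pCons[symmetric])
  have small: "act C f z = act B f z" if "degree f < d" for f
    using mon by (simp add: act_eq_sum[OF that])
  have Cp: "act C p z = 0"
  proof (cases "d = 0")
    case True
    then obtain c where "q = [:c:]" using degree_eq_zeroE unfolding d_def by blast
    moreover from this have "is_unit q" using pq(3) by (simp add: is_unit_const_poly_iff dvd_field_iff)
    hence "z = 0" using local_annD[OF z, of 1] by simp
    thus ?thesis by simp
  next
    case False
    then obtain e where e: "d = Suc e" using not0_implies_Suc by blast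
    define p0 where "p0 = p - monom 1 d"
    have "degree p0 < d"
    proof -
      have "degree p0 \<le> d" unfolding p0_def using pq(1)
        by (intro degree_diff_le) (simp_all add: d_def degree_monom_eq)
      moreover have "coeff p0 d = 0" using pq by (simp add: p0_def d_def)
      ultimately show ?thesis using False
        by (metis degree_0 eq_zero_or_degree_less gr0I)
    qed
    have p: "p = monom 1 d + p0" by (simp add: p0_def)
    \<comment> \<open>At exponent \<open>d\<close> the dyad takes effect for the first time:
      \<open>w\<close> is \<open>1\<close> on \<open>B^(d-1) z\<close>, so exactly
      \<open>p(B) z\<close> is subtracted.\<close>
    have "act C (monom 1 d) z = C *v act B (monom 1 e) z"
      unfolding e act_monom_Suc by (simp add: mon e)
    also have "\<dots> = act B (monom 1 d) z - act B p z"
      using w[of e] e by (simp add: C act_monom_Suc d_def)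
    finally show ?thesis
      using small[OF \<open>degree p0 < d\<close>] by (simp add: p act_add)
  qed
  \<comment> \<open>Remainders modulo \<open>p\<close> have degree below \<open>d\<close>, where
    \<open>B\<close> and \<open>C\<close> agree on \<open>z\<close>.\<close>
  have red: "act C f z = act B (f mod p) z" for f
  proof (cases "f mod p = 0")
    case True
    thus ?thesis using act_mod[OF Cp, of f] by simp
  next
    case False
    hence "degree (f mod p) < d" using degree_mod_less[OF p0, of f] pq(1) by (simp add: d_def)
    thus ?thesis using small act_mod[OF Cp, of f] by metis
  qed
  show "local_ann C z p"
    unfolding local_ann_def
  proof (intro allI iffI)
    fix f assume "act C f z = 0"
    hence "act B (f mod p) z = 0" by (simp add: red)
    hence "f mod p = 0"
      using local_ann_small[OF z, of "f mod p"] degree_mod_less[OF p0, of f] pq(1) by auto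
    thus "p dvd f" by (simp add: dvd_eq_mod_eq_0)
  next
    fix f assume "p dvd f"
    thus "act C f z = 0" by (simp add: red)
  qed
  show "cyc C z = cyc B z"
  proof (intro equalityI subsetI)
    fix x assume "x \<in> cyc C z"
    thus "x \<in> cyc B z" by (auto simp: red elim: cycE)
  next
    fix x assume "x \<in> cyc B z"
    then obtain f where "x = act B f z" by (rule cycE)
    hence f: "x = act B (f mod q) z" using act_mod[of B q z f] local_annD[OF z] by simp
    have "f mod q = 0 \<or> degree (f mod q) < d"
      using degree_mod_less[OF pq(3), of f] by (simp add: d_def)
    hence "x = act C (f mod q) z" using f small by auto
    thus "x \<in> cyc C z" by simp
  qed
  show "w \<noteq> 0" if "degree q \<noteq> 0"
    using w[of "degree q - 1"] that by (auto simp: vdot_def)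
qed

definition real_mat :: "complex^'n^'n \<Rightarrow> bool" where
  "real_mat B \<longleftrightarrow> (\<forall>i j. B $ i $ j \<in> \<real>)"

lemma real_vec_mult: "real_mat B \<Longrightarrow> real_vec x \<Longrightarrow> real_vec (B *v x)"
  by (simp add: real_mat_def real_vec_def matrix_vector_mult_def)

lemma real_vec_act:
  assumes "real_mat B" "real_vec x" "\<And>i. coeff f i \<in> \<real>"
  shows "real_vec (act B f x)"
  using assms(3)
proof (induction f)
  case (pCons a f)
  have "real_vec (act B f x)"
    using pCons.prems[of "Suc _"] by (intro pCons.IH) simp
  hence "real_vec (B *v act B f x)" by (rule real_vec_mult[OF assms(1)])
  thus ?case using pCons.prems[of 0] assms(2) by (simp add: act_pCons real_vec_def)
qed (simp add: real_vec_def)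

lemma ex_rank_one_placement:
  fixes B :: "complex^'n^'n::finite"
  assumes m: "min_poly B m" and p: "degree p = degree m" "lead_coeff p = 1"
  shows "\<exists>u w. (\<forall>k. vec.dim (geig (B + dyad u w) k) + order k m = vec.dim (geig B k) + order k p) \<and>
    (p \<noteq> m \<longrightarrow> u \<noteq> 0) \<and> w \<noteq> 0 \<and>
    (real_mat B \<and> (\<forall>i. coeff p i \<in> \<real>) \<longrightarrow> real_vec u \<and> real_vec w)"
proof -
  obtain z where z: "real_vec z" "local_ann B z m" by (rule ex_real_cyclic_vector[OF m])
  note m0 = min_polyD(2)[OF m]
  have m_nonconst: "degree m \<noteq> 0" by (rule degree_min_poly[OF m])
  let ?b = "\<lambda>i. act B (monom 1 i) z"
  have "inj_on ?b {..<degree m}" "vec.independent (?b ` {..<degree m})"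
    using act_monom_independent local_ann_small[OF z(2)] by blast+
  then obtain w0 where w0: "\<And>i. i < degree m \<Longrightarrow> vdot w0 (?b i) = (if i = degree m - 1 then 1 else 0)"
    by (rule ex_dual_vector) blast
  \<comment> \<open>In the real case real parts suffice: the vectors \<open>B^i z\<close> are real,
    and the prescribed pairings are \<open>0\<close> or \<open>1\<close>.\<close>
  define w where "w = (if real_mat B then \<chi> j. complex_of_real (Re (w0 $ j)) else w0)"
  have w: "vdot w (?b i) = (if i = degree m - 1 then 1 else 0)" if i: "i < degree m" for i
  proof (cases "real_mat B")
    case True
    have "real_vec (?b i)" using True z(1) by (intro real_vec_act) auto
    hence "vdot w (?b i) = of_real (Re (vdot w0 (?b i)))"
      using True by (simp add: vdot_def w_def real_vec_def complex_is_Real_iff complex_eq_iff)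
    thus ?thesis using w0[OF i] by simp
  qed (use w0[OF i] in \<open>simp add: w_def\<close>)
  note place = cyclic_rank_one_placement[OF z(2) p m0 w]
  define u where "u = - act B p z"
  have "p \<noteq> 0" using p(2) by auto
  have "vec.dim (geig (B + dyad u w) k) + order k m = vec.dim (geig B k) + order k p" for k
    unfolding u_def by (rule dim_geig_swap[OF z(2) m0 place(1) \<open>p \<noteq> 0\<close> place(2,3)])
  moreover have "w \<noteq> 0" using place(4) m_nonconst by blast
  \<comment> \<open>The dyad degenerates only if \<open>p(B) z = 0\<close>; then \<open>m\<close>
    divides \<open>p\<close>, and both are monic of the same degree.\<close>
  moreover have "p = m" if "u = 0"
  proof -
    have "m dvd p" using local_annD[OF z(2)] that by (simp add: u_def)
    then obtain h where h: "p = m * h" by (rule dvdE)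
    hence "degree h = 0" using p(1) \<open>p \<noteq> 0\<close> by (auto simp: degree_mult_eq)
    then obtain c where "h = [:c:]" by (rule degree_eq_zeroE)
    thus "p = m" using h p min_polyD(1)[OF m] by auto
  qed
  moreover have "real_vec u \<and> real_vec w" if "real_mat B" "\<forall>i. coeff p i \<in> \<real>"
    using real_vec_act[OF that(1) z(1), of p] that by (simp add: u_def w_def real_vec_def)
  ultimately show ?thesis by blast
qed

lemma vdot_diff_axis: "vdot (a *s axis i 1 - b *s axis j 1) x = a * x $ i - b * x $ j"
proof -
  have "(a *s axis i 1 - b *s axis j 1) $ k * x $ k =
      (if k = i then a * x $ k else 0) - (if k = j then b * x $ k else 0)" for k
    by (simp add: axis_def left_diff_distrib)
  thus ?thesis by (simp add: vdot_def sum_subtractf)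
qed

text \<open>For \<open>p = m\<close> the previous construction gives \<open>u = 0\<close>. Instead
  let \<open>u\<close> be an eigenvector and \<open>w\<close> a nonzero vector with
  \<open>w^T u = 0\<close>, which needs two coordinates: neither the map on the line through
  \<open>u\<close> nor the map on the quotient changes.\<close>

lemma ex_isospectral_dyad:
  fixes B :: "complex^'n^'n::finite"
  assumes "CARD('n) \<ge> 2"
  obtains u w where "\<And>k. vec.dim (geig (B + dyad u w) k) = vec.dim (geig B k)" "u \<noteq> 0" "w \<noteq> 0"
proof -
  obtain m where m: "min_poly B m" by (rule ex_min_poly)
  have "degree m \<noteq> 0" by (rule degree_min_poly[OF m])
  then obtain s where "poly m s = 0"
    using fundamental_theorem_of_algebra_alt[of m] by (metis degree_pCons_0)
  then obtain u where u: "u \<noteq> 0" "B *v u = s *s u" using poly_min_poly_eq_0_iff[OF m] by blast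
  obtain i :: 'n where i: "u $ i \<noteq> 0" using u(1) by (auto simp: vec_eq_iff)
  obtain j where j: "j \<noteq> i"
  proof (rule ccontr)
    assume "\<not> thesis"
    hence "UNIV = {i}" using that by blast
    hence "CARD('n) = card {i}" by (rule arg_cong)
    thus False using assms by simp
  qed
  define w where "w = u $ j *s axis i 1 - u $ i *s (axis j 1 :: complex^'n)"
  have "w $ j \<noteq> 0" using i j by (simp add: w_def axis_def)
  have wu: "vdot w u = 0"
    by (simp add: w_def vdot_diff_axis mult.commute)
  have Cu: "(B + dyad u w) *v u = s *s u"
    using u wu by (simp add: matrix_vector_mult_add_rdistrib dyad_mult_vec)
  have la: "local_ann D u [:- s, 1:]" if "D *v u = s *s u" for D
    using act_eigenvector[OF that] u(1) by (simp add: local_ann_def poly_eq_0_iff_dvd)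
  have cyc: "cyc D u = range (\<lambda>c. c *s u)" if "D *v u = s *s u" for D
  proof -
    have "c *s u \<in> cyc D u" for c
      using act_in_cyc[of D "[:c:]" u] by (simp add: act_pCons)
    thus ?thesis using act_eigenvector[OF that] by (auto simp: cyc_def)
  qed
  show ?thesis
  proof (rule that)
    show "vec.dim (geig (B + dyad u w) k) = vec.dim (geig B k)" for k
      using dim_geig_swap[OF la[OF u(2)] _ la[OF Cu], of k] cyc[OF u(2)] cyc[OF Cu]
      by (auto simp: matrix_vector_mult_add_rdistrib dyad_mult_vec)
    show "w \<noteq> 0" using \<open>w $ j \<noteq> 0\<close> by auto
  qed (rule u(1))
qed

subsection \<open>Jordan chains of pencils\<close>

text \<open>
  \<open>h\<close> is an arbitrary polynomial with \<open>poly h w \<noteq> 0\<close>, because the chains of the pencil at a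
  finite point and at infinity lead to different factors on the right-hand side.
\<close>

definition gchain :: "complex^'n^'n \<Rightarrow> complex \<Rightarrow> complex poly \<Rightarrow> (complex^'n) list \<Rightarrow> bool" where
  "gchain B w h g \<longleftrightarrow> g \<noteq> [] \<and> g ! 0 \<noteq> 0 \<and> act B [:- w, 1:] (g ! 0) = 0 \<and>
     (\<forall>j. 1 \<le> j \<and> j < length g \<longrightarrow> act B [:- w, 1:] (g ! j) = act B h (g ! (j - 1)))"

lemma chain_power:
  assumes "\<And>j. 1 \<le> j \<and> j \<le> n \<Longrightarrow> act B [:- w, 1:] (g j) = act B h (g (j - 1))" and "j \<le> n"
  shows "act B ([:- w, 1:] ^ j) (g j) = act B (h ^ j) (g 0)"
  using assms(2)
proof (induction j)
  case (Suc j)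
  have "act B ([:- w, 1:] ^ Suc j) (g (Suc j)) = act B ([:- w, 1:] ^ j) (act B [:- w, 1:] (g (Suc j)))"
    by (simp only: power_Suc2 act_mult)
  also have "\<dots> = act B ([:- w, 1:] ^ j) (act B h (g j))"
    using assms(1)[of "Suc j"] Suc.prems by simp
  also have "\<dots> = act B h (act B ([:- w, 1:] ^ j) (g j))" by (rule act_mult_commute)
  also have "\<dots> = act B (h ^ Suc j) (g 0)"
    using Suc by (simp add: act_mult)
  finally show ?case .
qed simp

text \<open>Descending the chain gives \<open>(B - w)^j g_j = h(B)^j g_0 = h(w)^j g_0\<close>, as
  \<open>g_0\<close> is an eigenvector. This is nonzero, and one more factor kills it.\<close>

lemma gchain_nth:
  assumes g: "gchain B w h g" and h: "poly h w \<noteq> 0" and j: "j < length g"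
  shows "g ! j \<in> gker B w (Suc j)" "g ! j \<notin> gker B w j"
proof -
  have pow: "act B ([:- w, 1:] ^ j) (g ! j) = act B (h ^ j) (g ! 0)"
    using g j by (intro chain_power[of "length g - 1"]) (auto simp: gchain_def)
  have "act B ([:- w, 1:] ^ Suc j) (g ! j) = act B [:- w, 1:] (act B ([:- w, 1:] ^ j) (g ! j))"
    by (simp only: power_Suc act_mult)
  also have "\<dots> = act B (h ^ j) (act B [:- w, 1:] (g ! 0))"
    unfolding pow by (rule act_mult_commute)
  also have "\<dots> = 0" using g by (simp add: gchain_def)
  finally show "g ! j \<in> gker B w (Suc j)" by (simp only: gker_def mem_Collect_eq)
  have "B *v (g ! 0) = w *s (g ! 0)" using g by (simp add: gchain_def act_linear_factor)
  from act_eigenvector[OF this, of "h ^ j"]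
  have "act B (h ^ j) (g ! 0) = poly h w ^ j *s (g ! 0)" by (simp add: poly_power)
  also have "\<dots> \<noteq> 0" using g h by (simp add: gchain_def)
  finally show "g ! j \<notin> gker B w j" by (simp add: gker_def pow)
qed

text \<open>\<open>h\<close> has an inverse \<open>a\<close> modulo \<open>(X - w)^(n+1)\<close>.
  The chain is built downwards from its last element \<open>x\<close> by applying
  \<open>a(B) (B - w)\<close> repeatedly.\<close>

lemma ex_gchain:
  assumes h: "poly h w \<noteq> 0" and x: "x \<in> gker B w (Suc n)" "x \<notin> gker B w n"
  obtains g where "gchain B w h g" "length g = Suc n" "x \<in> set g"
proof -
  let ?f = "[:- w, 1:]"
  have "prime_elem ?f"
    by (simp add: prime_elem_iff_irreducible irreducible_linear_field_poly)
  moreover have "\<not> ?f dvd h" using h by (simp add: poly_eq_0_iff_dvd)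
  ultimately have "coprime ?f h" by (rule prime_elem_imp_coprime)
  hence "coprime h (?f ^ Suc n)" by (simp add: coprime_commute del: power_Suc)
  then obtain a b where ab: "\<And>y. y = act B h (act B a y) + act B (?f ^ Suc n) (act B b y)"
    by (rule act_Bezout) blast
  define G where "G j = act B ((a * ?f) ^ (n - j)) x" for j
  have x0: "act B (?f ^ Suc n) x = 0" using x(1) by (simp only: gker_def mem_Collect_eq)
  have step: "act B ?f (G j) = act B h (G (j - 1))" if "1 \<le> j \<and> j \<le> n" for j
  proof -
    define y where "y = act B ?f (G j)"
    have "n - (j - 1) = Suc (n - j)" using that by arith
    hence "act B h (G (j - 1)) = act B h (act B a y)"
      by (simp only: G_def y_def power_Suc act_mult)
    moreover have "y = act B (?f * (a * ?f) ^ (n - j)) x"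
      by (simp only: y_def G_def act_mult)
    hence "act B (?f ^ Suc n) (act B b y) = 0"
      by (simp only: act_mult_commute[of B "?f ^ Suc n"] x0 act_zero_right)
    ultimately show ?thesis using ab[of y] by (simp add: y_def)
  qed
  have "G n = x" by (simp add: G_def)
  have "act B (h ^ n) (G 0) = act B (?f ^ n) x"
    using chain_power[where g = G and j = n, OF step order_refl] \<open>G n = x\<close> by metis
  hence "G 0 \<noteq> 0" using x(2) by (auto simp: gker_def)
  have "act B ?f (G 0) = act B (a ^ n * ?f ^ Suc n) x"
    by (simp only: G_def act_mult[symmetric] power_mult_distrib power_Suc diff_zero) (simp only: mult_ac)
  hence "act B ?f (G 0) = 0" by (simp only: act_mult x0 act_zero_right)
  define g where "g = map G [0..<Suc n]"
  have nth: "g ! j = G j" if "j \<le> n" for j using that by (simp add: g_def nth_append)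
  have len: "length g = Suc n" by (simp add: g_def)
  have "gchain B w h g"
    unfolding gchain_def
  proof (intro conjI allI impI)
    show "g \<noteq> []" by (simp add: g_def)
    show "g ! 0 \<noteq> 0" using \<open>G 0 \<noteq> 0\<close> by (simp add: nth)
    show "act B ?f (g ! 0) = 0" using \<open>act B ?f (G 0) = 0\<close> by (simp only: nth le0)
    fix j assume "1 \<le> j \<and> j < length g"
    hence j: "1 \<le> j \<and> j \<le> n" "j \<le> n" "j - 1 \<le> n" using len by auto
    show "act B ?f (g ! j) = act B h (g ! (j - 1))"
      unfolding nth[OF j(2)] nth[OF j(3)] by (rule step[OF j(1)])
  qed
  moreover have "x \<in> set g"
    using nth_mem[of n g] nth[of n] len \<open>G n = x\<close> by simp
  ultimately show ?thesis using that len by blast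
qed

lemma gchain_union:
  assumes "poly h w \<noteq> 0"
  shows "{0} \<union> (\<Union>g\<in>{g. gchain B w h g}. set g) = geig B w"
proof (intro equalityI subsetI)
  fix x assume "x \<in> {0} \<union> (\<Union>g\<in>{g. gchain B w h g}. set g)"
  thus "x \<in> geig B w"
    using gchain_nth(1)[OF _ assms] vec.subspace_0[OF subspace_geig]
    by (auto simp: in_set_conv_nth) (auto simp: geig_def)
next
  fix x assume "x \<in> geig B w"
  then obtain k where k: "x \<in> gker B w k" "\<And>j. j < k \<Longrightarrow> x \<notin> gker B w j"
    using exists_least_iff[of "\<lambda>k. x \<in> gker B w k"] by (auto simp: geig_def)
  show "x \<in> {0} \<union> (\<Union>g\<in>{g. gchain B w h g}. set g)"
  proof (cases k)
    case 0
    thus ?thesis using k by (simp add: gker_def)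
  next
    case (Suc n)
    with k obtain g where "gchain B w h g" "x \<in> set g"
      using ex_gchain[OF assms, of x B n] by auto
    thus ?thesis by blast
  qed
qed

text \<open>The last vector of a chain of length \<open>L\<close> lies in the \<open>L\<close>-th
  kernel but not in the previous one, and every such vector ends a chain of length
  \<open>L\<close>.\<close>

lemma gchain_lengths:
  assumes "poly h w \<noteq> 0" and m: "min_poly B m"
  shows "{length g | g. gchain B w h g} = {1..order w m}"
proof (intro equalityI subsetI)
  fix L assume "L \<in> {length g | g. gchain B w h g}"
  then obtain g where g: "gchain B w h g" "L = length g" by blast
  hence L: "L \<ge> 1" "L - 1 < length g" "Suc (L - 1) = L"
    by (simp_all add: gchain_def Suc_le_eq)
  have "g ! (L - 1) \<in> gker B w L" "g ! (L - 1) \<notin> gker B w (L - 1)"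
    using gchain_nth[OF g(1) assms(1) L(2)] L(3) by simp_all
  hence "L \<le> order w m" using gker_psubset_iff[OF m L(1)] by blast
  thus "L \<in> {1..order w m}" using L(1) by simp
next
  fix L assume L: "L \<in> {1..order w m}"
  then obtain x where "x \<in> gker B w L" "x \<notin> gker B w (L - 1)"
    using gker_psubset_iff[OF m, of L w] by auto
  then obtain g where "gchain B w h g" "length g = L"
    using ex_gchain[OF assms(1), of x B "L - 1"] L by auto
  thus "L \<in> {length g | g. gchain B w h g}" by blast
qed

section \<open>Reduction of a pencil to a matrix by a Moebius map\<close>

fun cay :: "complex \<Rightarrow> ecomplex \<Rightarrow> complex" where
  "cay c (Fin s) = 1 / (c - s)"
| "cay c Infty = 0"

text \<open>The pole \<open>Fin c\<close> must be left out: division by zero gives it the value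
  \<open>0\<close>, which belongs to \<open>Infty\<close>.\<close>

lemma cay_eq_iff:
  assumes "z \<noteq> Fin c" "z' \<noteq> Fin c"
  shows "cay c z = cay c z' \<longleftrightarrow> z = z'"
  using assms by (cases z; cases z') auto

lemma cay_surj: "\<exists>z. z \<noteq> Fin c \<and> cay c z = w"
proof (cases "w = 0")
  case True
  thus ?thesis by (intro exI[of _ Infty]) simp
next
  case False
  thus ?thesis by (intro exI[of _ "Fin (c - 1 / w)"]) simp
qed

lemma mat_mult_nth: "(mat z ** X) $ i $ j = z * (X :: complex^'m::finite^'n::finite) $ i $ j"
proof -
  have "(mat z ** X) $ i $ j = (\<Sum>k\<in>UNIV. if k = i then z * X $ k $ j else 0)"
    unfolding mat_def matrix_matrix_mult_def vec_lambda_beta by (intro sum.cong) auto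
  thus ?thesis by simp
qed

lemma mat_mult_mult_vec: "(mat z ** X) *v x = z *s (X *v (x :: complex^'n::finite))"
  by (simp add: vec_eq_iff matrix_vector_mult_def mat_mult_nth sum_distrib_left mult.assoc)

lemma invertible_iff_ker: "invertible (M :: complex^'n::finite^'n) \<longleftrightarrow> (\<forall>x. M *v x = 0 \<longrightarrow> x = 0)"
  by (simp add: invertible_left_inverse matrix_left_invertible_ker)

text \<open>With \<open>F\<close> the pencil at \<open>c\<close>, this is \<open>B = F^-1 E\<close>
  stated without an inverse, so that \<open>s E - A = F (1 + (s - c) B)\<close>.\<close>

definition shift_factor :: "complex \<Rightarrow> 'n::finite pencil \<Rightarrow> complex^'n^'n \<Rightarrow> bool" where
  "shift_factor c P B \<longleftrightarrow> invertible (pencil_at P (Fin c)) \<and> fst P = pencil_at P (Fin c) ** B"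

lemma shift_factor_mult_vec:
  assumes "shift_factor c (E, A) B"
  defines "F \<equiv> mat c ** E - A"
  shows "E *v x = F *v (B *v x)" "A *v x = F *v (c *s (B *v x) - x)"
    "F *v x = F *v y \<longleftrightarrow> x = y" "F *v x = 0 \<longleftrightarrow> x = 0"
proof -
  have inv: "invertible F" and E: "E = F ** B"
    using assms by (simp_all add: shift_factor_def F_def)
  show Ex: "E *v x = F *v (B *v x)" by (subst E) (simp add: matrix_vector_mul_assoc)
  have "F *v x = c *s (E *v x) - A *v x"
    by (simp add: F_def matrix_vector_mult_diff_rdistrib mat_mult_mult_vec)
  thus "A *v x = F *v (c *s (B *v x) - x)"
    by (simp add: Ex vec.diff vec.scale)
  show F0: "F *v x = 0 \<longleftrightarrow> x = 0" for x using inv by (auto simp: invertible_iff_ker)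
  show "F *v x = F *v y \<longleftrightarrow> x = y" using F0[of "x - y"] by (simp add: vec.diff)
qed

lemma scaled_eq_iff:
  fixes x y :: "complex^'n"
  assumes "d \<noteq> 0"
  shows "d *s x = y \<longleftrightarrow> x = (1 / d) *s y"
  using assms by (auto simp: vec_eq_iff field_simps)

lemma shift_factor_pencil_at:
  assumes P: "shift_factor c P B" and "z \<noteq> Fin c"
  shows "pencil_at P z *v x = 0 \<longleftrightarrow> x \<in> gker B (cay c z) 1"
proof -
  obtain E A where [simp]: "P = (E, A)" by (cases P)
  note F = shift_factor_mult_vec[OF P[simplified]]
  show ?thesis
  proof (cases z)
    case (Fin s)
    have d: "c - s \<noteq> 0" using assms(2) Fin by auto
    have "pencil_at P z *v x = (mat c ** E - A) *v (x - (c - s) *s (B *v x))"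
      by (simp add: Fin matrix_vector_mult_diff_rdistrib[of "mat s ** E"] mat_mult_mult_vec F(1,2)
          vec.diff[of "mat c ** E - A"] vec.scale[of "mat c ** E - A"] vec.scale_left_diff_distrib)
    hence "pencil_at P z *v x = 0 \<longleftrightarrow> (c - s) *s (B *v x) = x"
      by (simp only: F(4)) auto
    also have "\<dots> \<longleftrightarrow> B *v x = (1 / (c - s)) *s x" by (rule scaled_eq_iff[OF d])
    finally show ?thesis by (simp add: Fin gker_def act_linear_factor)
  next
    case Infty
    thus ?thesis by (simp add: F(1,4) gker_def act_pCons)
  qed
qed

lemma shift_factor_jordan_chain:
  assumes P: "shift_factor c P B" and "z \<noteq> Fin c"
  obtains h where "poly h (cay c z) \<noteq> 0" "\<And>g. jordan_chain P z g \<longleftrightarrow> gchain B (cay c z) h g"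
proof -
  obtain E A where [simp]: "P = (E, A)" by (cases P)
  note F = shift_factor_mult_vec[OF P[simplified]]
  show ?thesis
  proof (cases z)
    case (Fin s)
    have d: "c - s \<noteq> 0" using assms(2) Fin by auto
    define w where "w = cay c z"
    have w: "w = 1 / (c - s)" "w \<noteq> 0" "(c - s) * w = 1" using d by (simp_all add: w_def Fin)
    \<comment> \<open>Here \<open>A - s E = (c - s) F (B - w)\<close>. Cancelling \<open>F\<close>
      turns the recursion into \<open>(B - w) g_j = w B g_(j-1)\<close>, so \<open>h = w X\<close>,
      with \<open>h(w) = w^2 \<noteq> 0\<close>.\<close>
    have AE: "(A - mat s ** E) *v x = (mat c ** E - A) *v ((c - s) *s act B [:- w, 1:] x)" for x
      by (simp add: matrix_vector_mult_diff_rdistrib[of A] mat_mult_mult_vec F(1,2) act_linear_factor w(3)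
          vec.diff[of "mat c ** E - A"] vec.scale[of "mat c ** E - A"] vec.scale_left_diff_distrib
          vec.scale_right_diff_distrib)
    have "act B [:0, w:] y = (1 / (c - s)) *s (B *v y)" for y
      by (simp add: act_pCons w(1) vec.scale)
    hence "(A - mat s ** E) *v x = E *v y \<longleftrightarrow> act B [:- w, 1:] x = act B [:0, w:] y" for x y
      by (simp only: AE F(1,3) scaled_eq_iff[OF d])
    moreover have "(A - mat s ** E) *v x = 0 \<longleftrightarrow> act B [:- w, 1:] x = 0" for x
      unfolding AE F(4) using d by simp
    ultimately have "jordan_chain P z g \<longleftrightarrow> gchain B w [:0, w:] g" for g
      by (simp only: Fin gchain_def jordan_chain.simps \<open>P = (E, A)\<close>)
    moreover have "poly [:0, w:] w \<noteq> 0" using w(2) by simp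
    ultimately show ?thesis unfolding w_def using that by blast
  next
    case Infty
    \<comment> \<open>At infinity, \<open>E = F B\<close> and \<open>A = F (c B - 1)\<close> give
      \<open>B g_j = (c B - 1) g_(j-1)\<close>, so \<open>h = c X - 1\<close>, with value
      \<open>-1\<close> at \<open>0\<close>.\<close>
    have "E *v x = A *v y \<longleftrightarrow> act B [:- 0, 1:] x = act B [:- 1, c:] y" for x y
      by (simp add: F(1-3) act_pCons vec.scale)
    moreover have "E *v x = 0 \<longleftrightarrow> act B [:- 0, 1:] x = 0" for x
      by (simp add: F(1,4) act_pCons)
    ultimately have "jordan_chain P z g \<longleftrightarrow> gchain B 0 [:- 1, c:] g" for g
      by (simp only: Infty gchain_def jordan_chain.simps \<open>P = (E, A)\<close>)
    thus ?thesis using that[of "[:- 1, c:]"] by (simp add: Infty)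
  qed
qed

lemma shift_factor_root_subspace:
  assumes "shift_factor c P B" "z \<noteq> Fin c"
  shows "root_subspace P z = geig B (cay c z)"
proof -
  obtain h where h: "poly h (cay c z) \<noteq> 0" "\<And>g. jordan_chain P z g \<longleftrightarrow> gchain B (cay c z) h g"
    using shift_factor_jordan_chain[OF assms] by blast
  show ?thesis unfolding root_subspace_def h(2) by (rule gchain_union[OF h(1)])
qed

lemma shift_factor_root_subspace_self:
  assumes P: "shift_factor c P B"
  shows "root_subspace P (Fin c) = {0}"
proof -
  obtain E A where [simp]: "P = (E, A)" by (cases P)
  have "(A - mat c ** E) *v x = - ((mat c ** E - A) *v x)" for x
    by (simp add: matrix_vector_mult_diff_rdistrib)
  thus ?thesis
    using shift_factor_mult_vec(4)[OF P[simplified]] by (auto simp: root_subspace_def)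
qed

lemma shift_factor_spectrum:
  assumes P: "shift_factor c P B" and m: "min_poly B m"
  shows "z \<in> pencil_spectrum P \<longleftrightarrow> z \<noteq> Fin c \<and> poly m (cay c z) = 0"
proof (cases "z = Fin c")
  case True
  thus ?thesis using P by (simp add: pencil_spectrum_def shift_factor_def)
next
  case False
  thus ?thesis
    unfolding pencil_spectrum_def poly_min_poly_eq_0_iff[OF m]
    using shift_factor_pencil_at[OF P False]
    by (auto simp: invertible_iff_ker gker_def act_linear_factor)
qed

lemma shift_factor_max_chain_length:
  assumes P: "shift_factor c P B" and m: "min_poly B m" and z: "z \<in> pencil_spectrum P"
  shows "max_chain_length P z = order (cay c z) m"
proof -
  have z': "z \<noteq> Fin c" "poly m (cay c z) = 0" using z shift_factor_spectrum[OF P m] by auto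
  obtain h where h: "poly h (cay c z) \<noteq> 0" "\<And>g. jordan_chain P z g \<longleftrightarrow> gchain B (cay c z) h g"
    using shift_factor_jordan_chain[OF P z'(1)] by blast
  have "order (cay c z) m \<ge> 1"
    using z'(2) min_polyD(2)[OF m] by (simp add: order_root Suc_le_eq)
  hence "Max {1..order (cay c z) m} = order (cay c z) m" by (intro Max_eqI) auto
  thus ?thesis
    using gchain_lengths[OF h(1) m] by (simp add: max_chain_length_def h(2))
qed

text \<open>\<open>cay c\<close> matches eigenvalues with roots of \<open>m\<close> and longest
  chains with orders; over the complex numbers the orders add up to the degree.\<close>

lemma shift_factor_chain_total:
  assumes P: "shift_factor c P B" and m: "min_poly B m"
  shows "chain_total P = degree m"
proof -
  have "bij_betw (cay c) (pencil_spectrum P) {w. poly m w = 0}"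
    unfolding bij_betw_def
  proof
    show "inj_on (cay c) (pencil_spectrum P)"
      by (rule inj_onI) (simp add: cay_eq_iff shift_factor_spectrum[OF P m])
    show "cay c ` pencil_spectrum P = {w. poly m w = 0}"
    proof (intro equalityI subsetI)
      fix w assume "w \<in> cay c ` pencil_spectrum P"
      thus "w \<in> {w. poly m w = 0}" by (elim imageE) (simp add: shift_factor_spectrum[OF P m])
    next
      fix w assume w: "w \<in> {w. poly m w = 0}"
      obtain z where z: "z \<noteq> Fin c" "cay c z = w" using cay_surj by blast
      hence "z \<in> pencil_spectrum P" using w by (simp add: shift_factor_spectrum[OF P m])
      thus "w \<in> cay c ` pencil_spectrum P" using z(2) by blast
    qed
  qed
  hence "(\<Sum>z\<in>pencil_spectrum P. order (cay c z) m) = (\<Sum>w | poly m w = 0. order w m)"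
    by (rule sum.reindex_bij_betw)
  thus ?thesis
    using degree_eq_sum_order[OF min_polyD(2)[OF m]] shift_factor_max_chain_length[OF P m]
    by (simp add: chain_total_def)
qed

section \<open>Transfer of the multiplicity formulas to pencils\<close>

lemma order_le_dim_geig:
  fixes B :: "complex^'n^'n::finite"
  assumes m: "min_poly B m"
  shows "order w m \<le> vec.dim (geig B w)"
proof -
  obtain z where z: "local_ann B z m" using ex_real_cyclic_vector[OF m] by blast
  show ?thesis
    using dim_cyc_geig[OF z min_polyD(2)[OF m], of w] vec.dim_subset[of "cyc B z \<inter> geig B w" "geig B w"]
    by simp
qed

lemma poly_min_poly_eq_0_iff_geig:
  fixes B :: "complex^'n^'n::finite"
  assumes m: "min_poly B m"
  shows "poly m w = 0 \<longleftrightarrow> vec.dim (geig B w) \<noteq> 0"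
proof (cases "order w m = 0")
  case True
  hence "geig B w = {0}"
    using geig_eq_gker[OF m, of w 0] by (simp add: gker_def)
  thus ?thesis using True min_polyD(2)[OF m] by (simp add: order_root)
next
  case False
  hence "vec.dim (geig B w) \<noteq> 0" using order_le_dim_geig[OF m, of w] by linarith
  thus ?thesis using False min_polyD(2)[OF m] by (simp add: order_root del: vec.dim_eq_0)
qed

text \<open>The four cases of multiplicities are one identity: the order of \<open>p\<close> is
  \<open>e i\<close> at \<open>\<mu> i\<close> and \<open>0\<close> elsewhere, that of
  \<open>m\<close> is the longest chain length at eigenvalues and \<open>0\<close> elsewhere. The
  pole \<open>c\<close> of \<open>cay\<close> is treated apart; it lies in neither spectrum.\<close>

lemma placedI:
  fixes P Q :: "'n::finite pencil"
  assumes P: "shift_factor c P B" and Q: "shift_factor c Q C" and m: "min_poly B m"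
    and dim: "\<And>k. vec.dim (geig C k) + order k m = vec.dim (geig B k) + order k p"
    and \<mu>: "\<And>i. i \<in> {1..l} \<Longrightarrow> \<mu> i \<noteq> Fin c"
    and p: "\<And>i. i \<in> {1..l} \<Longrightarrow> order (cay c (\<mu> i)) p = e i" "\<And>i. i \<in> {1..l} \<Longrightarrow> e i \<noteq> 0"
      "\<And>z. z \<noteq> Fin c \<Longrightarrow> z \<notin> \<mu> ` {1..l} \<Longrightarrow> order (cay c z) p = 0"
  shows "placed_spectrum P l \<mu> Q" "placed_multiplicities P l \<mu> e Q"
proof -
  note m0 = min_polyD(2)[OF m]
  obtain n where n: "min_poly C n" by (rule ex_min_poly)
  note specP = shift_factor_spectrum[OF P m] and specQ = shift_factor_spectrum[OF Q n]
  have P': "int (vec.dim (root_subspace Q z)) =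
      int (vec.dim (root_subspace P z)) - int (order (cay c z) m) + int (order (cay c z) p)"
    if "z \<noteq> Fin c" for z
    using dim[of "cay c z"] that
    by (simp add: shift_factor_root_subspace[OF P] shift_factor_root_subspace[OF Q])
  have P0: "vec.dim (root_subspace P z) = 0" "order (cay c z) m = 0"
    if "z \<noteq> Fin c" "z \<notin> pencil_spectrum P" for z
    using that specP[of z] poly_min_poly_eq_0_iff_geig[OF m, of "cay c z"] m0
    by (simp_all add: shift_factor_root_subspace[OF P] order_root del: vec.dim_eq_0)
  show "placed_spectrum P l \<mu> Q"
    unfolding placed_spectrum_def
  proof (intro set_eqI)
    fix z
    show "z \<in> pencil_spectrum Q \<longleftrightarrow>
        z \<in> \<mu> ` {1..l} \<union> {z \<in> pencil_spectrum P. 2 \<le> ker_dim (pencil_at P z)}"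
    proof (cases "z = Fin c")
      case True
      moreover have "Fin c \<notin> \<mu> ` {1..l}" using \<mu> by (metis imageE)
      ultimately show ?thesis using specP[of z] specQ[of z] by simp
    next
      case z: False
      define w where "w = cay c z"
      have "z \<in> pencil_spectrum Q \<longleftrightarrow> vec.dim (geig C w) \<noteq> 0"
        using specQ z poly_min_poly_eq_0_iff_geig[OF n] by (simp add: w_def)
      \<comment> \<open>What survives of the old generalised eigenspace has dimension
        \<open>vec.dim (geig B w) - order w m\<close>, which is positive exactly if the eigenspace
        has dimension at least two.\<close>
      also have "\<dots> \<longleftrightarrow> order w p \<noteq> 0 \<or> order w m < vec.dim (geig B w)"
        using dim[of w] order_le_dim_geig[OF m, of w] by linarith
      also have "order w p \<noteq> 0 \<longleftrightarrow> z \<in> \<mu> ` {1..l}"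
        using p(1,2) p(3)[OF z] by (force simp: w_def)
      also have "order w m < vec.dim (geig B w) \<longleftrightarrow>
          z \<in> pencil_spectrum P \<and> 2 \<le> ker_dim (pencil_at P z)"
      proof (cases "poly m w = 0")
        case True
        have "ker_dim (pencil_at P z) = vec.dim (gker B w 1)"
          using shift_factor_pencil_at[OF P z] by (simp add: ker_dim_def w_def)
        thus ?thesis using two_le_dim_eigenspace_iff[OF m True] True specP z by (simp add: w_def)
      next
        case False
        hence "vec.dim (geig B w) = 0" using poly_min_poly_eq_0_iff_geig[OF m] by blast
        thus ?thesis using False specP by (simp add: w_def del: vec.dim_eq_0)
      qed
      finally show ?thesis by auto
    qed
  qed
  show "placed_multiplicities P l \<mu> e Q"
    unfolding placed_multiplicities_def
  proof (intro conjI ballI allI impI)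
    fix i assume "i \<in> {1..l}" "\<mu> i \<in> pencil_spectrum P"
    thus "int (vec.dim (root_subspace Q (\<mu> i))) =
        int (vec.dim (root_subspace P (\<mu> i))) - int (max_chain_length P (\<mu> i)) + int (e i)"
      using P'[of "\<mu> i"] p(1)[of i] \<mu>[of i] by (simp add: shift_factor_max_chain_length[OF P m])
  next
    fix z assume "z \<in> pencil_spectrum P - \<mu> ` {1..l}"
    thus "int (vec.dim (root_subspace Q z)) =
        int (vec.dim (root_subspace P z)) - int (max_chain_length P z)"
      using P'[of z] p(3)[of z] specP[of z] by (simp add: shift_factor_max_chain_length[OF P m])
  next
    fix i assume "i \<in> {1..l}" "\<mu> i \<notin> pencil_spectrum P"
    thus "vec.dim (root_subspace Q (\<mu> i)) = e i"
      using P'[of "\<mu> i"] P0[of "\<mu> i"] p(1)[of i] \<mu>[of i] by simp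
  next
    fix z assume z: "z \<notin> pencil_spectrum P \<union> \<mu> ` {1..l}"
    show "vec.dim (root_subspace Q z) = 0"
    proof (cases "z = Fin c")
      case True
      thus ?thesis by (simp add: shift_factor_root_subspace_self[OF Q])
    next
      case False
      thus ?thesis using P'[of z] P0[of z] p(3)[of z] z by simp
    qed
  qed
qed

section \<open>Perturbed pencils and the choice of the shift\<close>

lemma dyad_pencil_eq: "dyad_pencil a b u w = (mat a ** dyad u w, mat b ** dyad u w)"
  by (simp add: dyad_pencil_def dyad_def vec_eq_iff mat_mult_nth)

text \<open>The added pencil \<open>(s - c) (F u) w^T\<close> vanishes at \<open>c\<close>, so
  \<open>F\<close> is unchanged, while \<open>E + (F u) w^T = F (B + u w^T)\<close>.\<close>

lemma shift_factor_add_dyad: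
  assumes P: "shift_factor c (E, A) B"
  shows "shift_factor c ((E, A) + dyad_pencil 1 c ((mat c ** E - A) *v u) w) (B + dyad u w)"
proof -
  let ?F = "mat c ** E - A"
  have eq: "mat c ** (E + dyad (?F *v u) w) - (A + mat c ** dyad (?F *v u) w) = ?F"
    by (simp add: matrix_add_ldistrib)
  have E: "E + dyad (?F *v u) w = ?F ** (B + dyad u w)"
    unfolding matrix_eq
    by (simp add: matrix_vector_mul_assoc[symmetric] matrix_vector_mult_add_rdistrib dyad_mult_vec
        shift_factor_mult_vec(1)[OF P] vec.add[of ?F] vec.scale[of ?F])
  have inv: "invertible ?F" using P by (simp add: shift_factor_def)
  have sum: "(E, A) + dyad_pencil 1 c (?F *v u) w =
      (E + dyad (?F *v u) w, A + mat c ** dyad (?F *v u) w)"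
    by (simp add: dyad_pencil_eq)
  show ?thesis
    unfolding sum shift_factor_def pencil_at.simps fst_conv eq using inv E by (rule conjI)
qed

text \<open>Both \<open>E\<close> and \<open>F\<close> are doubled, which keeps \<open>B\<close>.
  For \<open>n = 1\<close> this stands in for the isospectral dyad.\<close>

lemma shift_factor_double:
  assumes P: "shift_factor c (E, A) B"
  shows "shift_factor c ((E, A) + (E, A)) B"
proof -
  let ?F = "mat c ** E - A"
  have eq: "mat c ** (E + E) - (A + A) = ?F + ?F"
    by (simp only: matrix_add_ldistrib add_diff_add)
  have ker: "(?F + ?F) *v x = 0 \<longleftrightarrow> ?F *v x = 0" for x
    by (simp only: matrix_vector_mult_add_rdistrib) (simp add: vec_eq_iff)
  have E: "E + E = (?F + ?F) ** B"
    unfolding matrix_eq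
    by (simp only: matrix_vector_mul_assoc[symmetric] matrix_vector_mult_add_rdistrib
        shift_factor_mult_vec(1)[OF P] simp_thms)
  have "invertible ?F" using P by (simp add: shift_factor_def)
  hence inv: "invertible (?F + ?F)" by (simp only: invertible_iff_ker ker)
  show ?thesis
    unfolding shift_factor_def add_Pair pencil_at.simps fst_conv eq using inv E by (rule conjI)
qed

lemma poly_det_pencil_poly: "poly (det (pencil_poly P)) s = det (pencil_at P (Fin s))"
proof -
  obtain E A where [simp]: "P = (E, A)" by (cases P)
  have "(mat s ** E - A) $ i $ j = poly [:- (A $ i $ j), E $ i $ j:] s" for i j
    by (simp add: mat_mult_nth)
  thus ?thesis
    by (simp add: det_def pencil_poly_def poly_sum poly_prod)
qed

lemma shift_factor_regular: "shift_factor c P B \<Longrightarrow> regular_pencil P"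
  using poly_det_pencil_poly[of P c]
  by (auto simp: shift_factor_def regular_pencil_def invertible_det_nz)

text \<open>Only finitely many zeros of the determinant and points of \<open>S\<close> have to be
  avoided, and there are infinitely many reals.\<close>

lemma ex_shift_factor:
  assumes "regular_pencil P" "finite S"
  obtains c B where "c \<in> \<real>" "Fin c \<notin> S" "shift_factor c P B"
proof -
  define D where "D = det (pencil_poly P)"
  have "D \<noteq> 0" using assms(1) by (simp add: regular_pencil_def D_def)
  hence "finite ({s. poly D s = 0} \<union> {s. Fin s \<in> S})"
    using assms(2) finite_vimageI[of S Fin] by (simp add: poly_roots_finite vimage_def inj_def)
  moreover have "infinite (\<real> :: complex set)"
    unfolding Reals_def by (simp add: finite_image_iff inj_of_real infinite_UNIV_char_0)
  ultimately obtain c where c: "c \<in> \<real>" "poly D c \<noteq> 0" "Fin c \<notin> S"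
    using finite_subset[of "\<real>" "{s. poly D s = 0} \<union> {s. Fin s \<in> S}"] by blast
  let ?F = "pencil_at P (Fin c)"
  have inv: "invertible ?F"
    using c(2) poly_det_pencil_poly[of P c] by (simp add: invertible_det_nz D_def)
  then obtain G where "?F ** G = mat 1" by (auto simp: invertible_def)
  hence "?F ** (G ** fst P) = fst P" by (simp add: matrix_mul_assoc)
  hence "shift_factor c P (G ** fst P)" using inv by (simp add: shift_factor_def)
  thus ?thesis using that c by blast
qed

text \<open>As \<open>F\<close> and \<open>E\<close> are real, the conjugate of \<open>B\<close>
  solves the same equation \<open>F B' = E\<close>, and \<open>F\<close> can be cancelled.\<close>

lemma shift_factor_real:
  assumes P: "shift_factor c (E, A) B" and "c \<in> \<real>" "real_mat E" "real_mat A"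
  shows "real_mat (mat c ** E - A)" "real_mat B"
proof -
  let ?F = "mat c ** E - A"
  show F: "real_mat ?F"
    using assms(2-4)
    by (simp add: real_mat_def mat_mult_nth)
  define B' where "B' = (\<chi> i j. cnj (B $ i $ j))"
  have E: "?F ** B = E" using P by (simp add: shift_factor_def)
  have "(?F ** B') $ i $ j = E $ i $ j" for i j
  proof -
    have "(?F ** B') $ i $ j = cnj ((?F ** B) $ i $ j)"
      using F by (simp add: matrix_matrix_mult_def B'_def real_mat_def Reals_cnj_iff)
    thus ?thesis using assms(3) unfolding E by (simp add: real_mat_def Reals_cnj_iff)
  qed
  hence "?F ** B' = ?F ** B" unfolding E by (simp add: vec_eq_iff)
  hence "?F *v (B' *v x) = ?F *v (B *v x)" for x by (simp add: matrix_vector_mul_assoc)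
  hence "B' = B" unfolding matrix_eq using shift_factor_mult_vec(3)[OF P] by blast
  thus "real_mat B" by (simp add: real_mat_def B'_def vec_eq_iff Reals_cnj_iff)
qed

subsection \<open>The rank of a dyad pencil\<close>

text \<open>Composing with a transposition permutes the summands and flips all signs, so the sum is
  its own negative.\<close>

lemma sum_sign_permutes:
  assumes "finite S" "a \<in> S" "b \<in> S" "a \<noteq> b"
  shows "(\<Sum>p | p permutes S. sign p) = 0"
proof -
  let ?t = "Transposition.transpose a b"
  have t: "?t permutes S" using assms by (intro permutes_swap_id)
  have "(\<Sum>p | p permutes S. sign p) = (\<Sum>p | p permutes S. sign (?t \<circ> p))"
    by (rule setum_permutations_compose_left[OF t])
  also have "\<dots> = (\<Sum>p | p permutes S. - sign p)"
  proof (intro sum.cong refl)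
    fix p assume "p \<in> {p. p permutes S}"
    hence "permutation p" using assms(1) permutes_imp_permutation by blast
    thus "sign (?t \<circ> p) = - sign p"
      using assms(4) by (simp add: sign_compose permutation_swap_id sign_swap_id)
  qed
  finally show ?thesis by (simp add: sum_negf)
qed

text \<open>The Leibniz product is the same for every permutation, so the minor is a multiple of the
  sum of all signs.\<close>

lemma minor_dyad:
  assumes "r \<ge> 2"
  shows "minor r f g (\<chi> i j. q * ([:u i * w j:] :: complex poly)) = 0"
proof -
  define K where "K = (\<Prod>i<r. q * [:u (f i):]) * (\<Prod>i<r. [:w (g i):])"
  have "(\<Prod>i<r. q * [:u (f i) * w (g (p i)):]) = K" if "p permutes {..<r}" for p
  proof -
    have "(\<Prod>i<r. q * [:u (f i) * w (g (p i)):]) = (\<Prod>i<r. q * [:u (f i):]) * (\<Prod>i<r. [:w (g (p i)):])"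
      unfolding prod.distrib[symmetric] by (intro prod.cong) (simp_all add: mult.commute)
    also have "(\<Prod>i<r. [:w (g (p i)):]) = (\<Prod>i<r. [:w (g i):])"
      by (rule prod.permute[OF that, unfolded o_def, symmetric])
    finally show ?thesis by (simp add: K_def)
  qed
  hence "minor r f g (\<chi> i j. q * [:u i * w j:]) = of_int (\<Sum>p | p permutes {..<r}. sign p) * K"
    by (simp add: minor_def sum_distrib_right)
  thus ?thesis
    using sum_sign_permutes[of "{..<r}" 0 1] assms by simp
qed

lemma pencil_rank_dyad:
  assumes "a \<noteq> 0" "u \<noteq> 0" "w \<noteq> 0"
  shows "pencil_rank (dyad_pencil a b u w) = 1"
proof -
  define M where "M = (\<chi> i j. [:- b, a:] * [:u $ i * w $ j:])"
  have M: "pencil_poly (dyad_pencil a b u w) = M"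
    by (simp add: pencil_poly_def dyad_pencil_def M_def vec_eq_iff)
  obtain i j where ij: "u $ i \<noteq> 0" "w $ j \<noteq> 0"
    using assms(2,3) by (auto simp: vec_eq_iff)
  have "minor 0 f g M \<noteq> 0" for f g by (simp add: minor_def)
  moreover have "minor 1 (\<lambda>_. i) (\<lambda>_. j) M \<noteq> 0"
    using assms(1) ij by (simp add: minor_def M_def lessThan_Suc)
  moreover have "r \<in> {0, 1}" if "minor r f g M \<noteq> 0" for r f g
  proof -
    have "\<not> 2 \<le> r" using that minor_dyad[of r] unfolding M_def by blast
    thus ?thesis by auto
  qed
  ultimately have "{r. \<exists>f g. inj_on f {..<r} \<and> inj_on g {..<r} \<and> minor r f g M \<noteq> 0} = {0, 1}"
    by (intro equalityI subsetI) (blast, auto simp: lessThan_Suc intro!: exI)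
  thus ?thesis by (simp add: pencil_rank_def M)
qed

subsection \<open>Placement of eigenvalues\<close>

lemma vcnj_vcnj [simp]: "vcnj (vcnj v) = v"
  by (simp add: vcnj_def vec_eq_iff)

lemma real_vec_cvec:
  assumes "real_vec x"
  shows "cvec (\<chi> i. Re (x $ i)) = x"
  using assms by (simp add: cvec_def real_vec_def vec_eq_iff)

lemma order_prod_linear_powers:
  fixes a :: "'i \<Rightarrow> complex"
  assumes "finite I"
  shows "order k (\<Prod>i\<in>I. [:- a i, 1:] ^ e i) = (\<Sum>i\<in>I. if a i = k then e i else 0)"
  using assms
proof induction
  case (insert i I)
  have "order k ([:- a i, 1:] ^ e i) = (if a i = k then e i else 0)"
    by (auto simp: order_power_n_n intro: order_0I)
  moreover have "[:- a i, 1:] ^ e i * (\<Prod>i\<in>I. [:- a i, 1:] ^ e i) \<noteq> 0"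
    using insert.hyps by (simp add: prod_zero_iff)
  ultimately show ?case using insert by (simp add: order_mult)
qed simp

lemma monic_prod_linear_powers: "lead_coeff (\<Prod>i\<in>I. [:- a i :: complex, 1:] ^ e i) = 1"
  by (simp add: lead_coeff_prod lead_coeff_power)

lemma degree_prod_linear_powers: "degree (\<Prod>i\<in>I. [:- a i :: complex, 1:] ^ e i) = (\<Sum>i\<in>I. e i)"
  by (subst degree_prod_eq_sum_degree) (simp_all add: degree_linear_power)

lemma cnj_cay: "c \<in> \<real> \<Longrightarrow> cnj (cay c z) = cay c (ecnj z)"
  by (cases z) (simp_all add: Reals_cnj_iff)

lemma ecnj_ecnj [simp]: "ecnj (ecnj z) = z"
  by (cases z) simp_all

text \<open>For real \<open>c\<close> the map \<open>cay c\<close> commutes with conjugation, which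
  therefore permutes the linear factors and respects their exponents.\<close>

lemma coeff_symmetric_prod_real:
  fixes \<mu> :: "nat \<Rightarrow> ecomplex"
  assumes c: "c \<in> \<real>" and inj: "inj_on \<mu> I" and "finite I"
    and sym: "ecnj ` \<mu> ` I = \<mu> ` I"
    and e: "\<And>i j. i \<in> I \<Longrightarrow> j \<in> I \<Longrightarrow> \<mu> j = ecnj (\<mu> i) \<Longrightarrow> e i = e j"
  shows "coeff (\<Prod>i\<in>I. [:- cay c (\<mu> i), 1:] ^ e i) n \<in> \<real>"
proof -
  define p where "p = (\<Prod>i\<in>I. [:- cay c (\<mu> i), 1:] ^ e i)"
  have "\<exists>j\<in>I. \<mu> j = ecnj (\<mu> i)" if "i \<in> I" for i
    using that sym by (metis imageE imageI)
  then obtain \<sigma> where \<sigma>: "\<And>i. i \<in> I \<Longrightarrow> \<sigma> i \<in> I" "\<And>i. i \<in> I \<Longrightarrow> \<mu> (\<sigma> i) = ecnj (\<mu> i)"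
    by metis
  have "inj_on \<sigma> I"
    using inj \<sigma>(2) by (metis ecnj_ecnj inj_on_def)
  hence bij: "bij_betw \<sigma> I I"
    using \<sigma>(1) \<open>finite I\<close> by (simp add: bij_betw_def endo_inj_surj image_subsetI)
  have "poly (map_poly cnj p) x = poly p x" for x
  proof -
    have "poly (map_poly cnj p) x = (\<Prod>i\<in>I. (x - cay c (\<mu> (\<sigma> i))) ^ e (\<sigma> i))"
      using \<sigma> e[OF _ \<sigma>(1) \<sigma>(2)] by (simp add: p_def poly_prod poly_power cnj_cay[OF c])
    also have "\<dots> = (\<Prod>i\<in>I. (x - cay c (\<mu> i)) ^ e i)"
      by (rule prod.reindex_bij_betw[OF bij])
    finally show ?thesis by (simp add: p_def poly_prod poly_power)
  qed
  hence "map_poly cnj p = p" by (simp add: poly_eq_poly_eq_iff[symmetric] fun_eq_iff)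
  hence "cnj (coeff p n) = coeff p n" by (metis coeff_map_poly complex_cnj_zero)
  thus ?thesis by (simp add: p_def Reals_cnj_iff)
qed

theorem theorem5p1:
  fixes E A :: "complex^'n^'n::finite"
    and l :: nat and \<mu> :: "nat \<Rightarrow> ecomplex" and m :: "nat \<Rightarrow> nat"
  assumes reg: "regular_pencil (E, A)"
    and distinct: "inj_on \<mu> {1..l}"
    and l_le: "l \<le> chain_total (E, A)"
    and m_pos: "\<And>i. i \<in> {1..l} \<Longrightarrow> m i \<noteq> 0"
    and m_sum: "(\<Sum>i=1..l. m i) = chain_total (E, A)"
  shows
    "(\<exists>(\<alpha>::complex) (\<beta>::complex) (u::complex^'n) (v::complex^'n).
        \<alpha> \<noteq> 0 \<and>
        (\<not> (CARD('n) = 1 \<and> E = 0 \<and> \<mu> ` {1..l} = {Infty})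
           \<longrightarrow> pencil_rank (dyad_pencil \<alpha> \<beta> u (vcnj v)) = 1) \<and>
        regular_pencil ((E, A) + dyad_pencil \<alpha> \<beta> u (vcnj v)) \<and>
        placed_spectrum (E, A) l \<mu> ((E, A) + dyad_pencil \<alpha> \<beta> u (vcnj v)) \<and>
        placed_multiplicities (E, A) l \<mu> m ((E, A) + dyad_pencil \<alpha> \<beta> u (vcnj v)))
     \<and>
     ((\<forall>i j. E $ i $ j \<in> \<real> \<and> A $ i $ j \<in> \<real>) \<and>
      ecnj ` \<mu> ` {1..l} = \<mu> ` {1..l} \<and>
      (\<forall>i\<in>{1..l}. \<forall>j\<in>{1..l}. \<mu> j = ecnj (\<mu> i) \<longrightarrow> m i = m j)
      \<longrightarrow>
      (\<exists>(\<alpha>::real) (\<beta>::real) (u::real^'n) (v::real^'n).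
         placed_spectrum (E, A) l \<mu>
           ((E, A) + dyad_pencil (of_real \<alpha>) (of_real \<beta>) (cvec u) (cvec v)) \<and>
         placed_multiplicities (E, A) l \<mu> m
           ((E, A) + dyad_pencil (of_real \<alpha>) (of_real \<beta>) (cvec u) (cvec v))))"
proof -
  obtain c B where c: "c \<in> \<real>" "Fin c \<notin> \<mu> ` {1..l}" and P: "shift_factor c (E, A) B"
    using ex_shift_factor[OF reg, of "\<mu> ` {1..l}"] by blast
  define F where "F = mat c ** E - A"
  obtain q where q: "min_poly B q" by (rule ex_min_poly)
  define p where "p = (\<Prod>i\<in>{1..l}. [:- cay c (\<mu> i), 1:] ^ m i)"
  \<comment> \<open>The condition on the sum of the \<open>m i\<close> gives \<open>p\<close> the
    degree of the minimal polynomial.\<close>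
  have deg: "degree p = degree q"
    unfolding p_def degree_prod_linear_powers m_sum by (rule shift_factor_chain_total[OF P q])
  have monic: "lead_coeff p = 1" unfolding p_def by (rule monic_prod_linear_powers)
  have ord: "order (cay c z) p = (\<Sum>i\<in>{1..l}. if \<mu> i = z then m i else 0)" if "z \<noteq> Fin c" for z
  proof -
    have "cay c (\<mu> i) = cay c z \<longleftrightarrow> \<mu> i = z" if i: "i \<in> {1..l}" for i
      using c(2) i by (intro cay_eq_iff \<open>z \<noteq> Fin c\<close>) (metis imageI)
    thus ?thesis unfolding p_def by (subst order_prod_linear_powers) (auto intro!: sum.cong)
  qed
  have \<mu>c: "\<mu> i \<noteq> Fin c" if "i \<in> {1..l}" for i using c(2) that by (metis imageI)
  have ord_\<mu>: "order (cay c (\<mu> i)) p = m i" if i: "i \<in> {1..l}" for i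
  proof -
    have "order (cay c (\<mu> i)) p = (\<Sum>j\<in>{1..l}. if j = i then m j else 0)"
      unfolding ord[OF \<mu>c[OF i]] using inj_onD[OF distinct _ _ i] by (intro sum.cong) auto
    thus ?thesis using i by simp
  qed
  have ord_0: "order (cay c z) p = 0" if "z \<noteq> Fin c" "z \<notin> \<mu> ` {1..l}" for z
    unfolding ord[OF that(1)] using that(2) by (intro sum.neutral) auto
  have place: "placed_spectrum (E, A) l \<mu> Q" "placed_multiplicities (E, A) l \<mu> m Q" "regular_pencil Q"
    if "shift_factor c Q C"
      "\<And>k. vec.dim (geig C k) + order k q = vec.dim (geig B k) + order k p" for Q C
    using placedI[where l = l and \<mu> = \<mu> and e = m, OF P that(1) q that(2) \<mu>c ord_\<mu> m_pos ord_0] shift_factor_regular[OF that(1)]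
    by blast+
  obtain u w where uw:
    "\<forall>k. vec.dim (geig (B + dyad u w) k) + order k q = vec.dim (geig B k) + order k p"
    "p \<noteq> q \<longrightarrow> u \<noteq> 0" "w \<noteq> 0"
    "real_mat B \<and> (\<forall>i. coeff p i \<in> \<real>) \<longrightarrow> real_vec u \<and> real_vec w"
    using ex_rank_one_placement[OF q deg monic] by blast
  note sf = shift_factor_add_dyad[OF P, folded F_def]
  have F0: "F *v x = 0 \<longleftrightarrow> x = 0" for x
    using shift_factor_mult_vec(4)[OF P] by (simp add: F_def)
  let ?goal = "\<lambda>\<alpha> \<beta> u v. \<alpha> \<noteq> 0 \<and>
        (\<not> (CARD('n) = 1 \<and> E = 0 \<and> \<mu> ` {1..l} = {Infty})
           \<longrightarrow> pencil_rank (dyad_pencil \<alpha> \<beta> u (vcnj v)) = 1) \<and>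
        regular_pencil ((E, A) + dyad_pencil \<alpha> \<beta> u (vcnj v)) \<and>
        placed_spectrum (E, A) l \<mu> ((E, A) + dyad_pencil \<alpha> \<beta> u (vcnj v)) \<and>
        placed_multiplicities (E, A) l \<mu> m ((E, A) + dyad_pencil \<alpha> \<beta> u (vcnj v))"
  \<comment> \<open>If \<open>n = 1\<close>, \<open>E = 0\<close> and only infinity is prescribed, a
    rank one pencil with \<open>\<alpha> \<noteq> 0\<close> would make the leading coefficient
    nonzero and remove infinity from the spectrum; there \<open>u = 0\<close> is accepted.\<close>
  have generic: "?goal 1 c (F *v u) (vcnj w)"
    if "u \<noteq> 0 \<or> CARD('n) = 1 \<and> E = 0 \<and> \<mu> ` {1..l} = {Infty}"
    using place[OF sf spec[OF uw(1)]] that uw(3) pencil_rank_dyad[of 1 "F *v u" w c] by (auto simp: F0)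
  have "\<exists>\<alpha> \<beta> u v. ?goal \<alpha> \<beta> u v"
  proof (cases "p = q")
    case False
    thus ?thesis using generic uw(2) by blast
  next
    \<comment> \<open>Now no root subspace may change its dimension, and \<open>u\<close> may
      vanish; outside the exceptional case another, nonzero dyad is needed.\<close>
    case pq: True
    show ?thesis
    proof (cases "CARD('n) = 1")
      case False
      hence "CARD('n) \<ge> 2" using zero_less_card_finite[where 'a = 'n] by linarith
      then obtain u' w' where "\<And>k. vec.dim (geig (B + dyad u' w') k) = vec.dim (geig B k)" "u' \<noteq> 0" "w' \<noteq> 0"
        using ex_isospectral_dyad[of B] by blast
      hence "?goal 1 c (F *v u') (vcnj w')"
        using place[OF sf, of u' w'] pencil_rank_dyad[of 1 "F *v u'" w' c] pq by (simp add: F0)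
      thus ?thesis by blast
    next
      case card: True
      then obtain k :: 'n where k: "UNIV = {k}" by (metis card_1_singletonE)
      have entry: "M $ k $ k = M $ i $ j" for M :: "complex^'n^'n" and i j
      proof -
        have "i = k" "j = k" using k by blast+
        thus ?thesis by simp
      qed
      show ?thesis
      proof (cases "E = 0")
        case False
        define o1 :: "complex^'n" where "o1 = (\<chi> i. 1)"
        \<comment> \<open>With a single coordinate the pencil is itself a dyad pencil and can be
          added to itself; \<open>\<alpha>\<close> is the nonzero entry of \<open>E\<close>.\<close>
        have dy: "dyad_pencil (E $ k $ k) (A $ k $ k) o1 o1 = (E, A)"
          by (simp add: dyad_pencil_def o1_def vec_eq_iff) (intro conjI allI entry)
        have Ek: "E $ k $ k \<noteq> 0"
        proof
          assume "E $ k $ k = 0"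
          hence "E $ i $ j = 0" for i j using entry[of E i j] by simp
          thus False using False by (simp add: vec_eq_iff)
        qed
        have "o1 \<noteq> 0" by (simp add: o1_def vec_eq_iff)
        hence "pencil_rank (E, A) = 1" using pencil_rank_dyad[OF Ek, of o1 o1 "A $ k $ k"] dy by simp
        moreover have "regular_pencil ((E, A) + (E, A))"
          "placed_spectrum (E, A) l \<mu> ((E, A) + (E, A))"
          "placed_multiplicities (E, A) l \<mu> m ((E, A) + (E, A))"
          using place[OF shift_factor_double[OF P]] pq by auto
        ultimately have "?goal (E $ k $ k) (A $ k $ k) o1 (vcnj o1)"
          using Ek by (simp only: vcnj_vcnj dy) simp
        thus ?thesis by blast
      next
        case E: True
        \<comment> \<open>From \<open>E = 0\<close> it follows that \<open>B\<close> has only the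
          eigenvalue \<open>0\<close>, which is \<open>cay c Infty\<close>.\<close>
        have "\<mu> i = Infty" if i: "i \<in> {1..l}" for i
        proof -
          have "poly q (cay c (\<mu> i)) = 0"
            using ord_\<mu>[OF i] m_pos[OF i] pq order_root[of q] by auto
          then obtain x where x: "x \<noteq> 0" "B *v x = cay c (\<mu> i) *s x"
            using poly_min_poly_eq_0_iff[OF q] by blast
          have "F *v (B *v x) = 0"
            using shift_factor_mult_vec(1)[OF P, of x] E by (simp add: F_def)
          hence "cay c (\<mu> i) = 0" using x by (simp add: F0)
          thus ?thesis using \<mu>c[OF i] by (cases "\<mu> i") auto
        qed
        moreover have "{1..l} \<noteq> {}"
        proof
          assume "{1..l} = {}"
          hence "p = 1" unfolding p_def by (simp only: prod.empty)
          thus False using deg degree_min_poly[OF q] by simp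
        qed
        ultimately have "\<mu> ` {1..l} = {Infty}" by (auto simp: image_iff)
        thus ?thesis using generic card E by blast
      qed
    qed
  qed
  moreover have "\<exists>(\<alpha>::real) (\<beta>::real) (u::real^'n) (v::real^'n).
         placed_spectrum (E, A) l \<mu>
           ((E, A) + dyad_pencil (of_real \<alpha>) (of_real \<beta>) (cvec u) (cvec v)) \<and>
         placed_multiplicities (E, A) l \<mu> m
           ((E, A) + dyad_pencil (of_real \<alpha>) (of_real \<beta>) (cvec u) (cvec v))"
    if real: "\<forall>i j. E $ i $ j \<in> \<real> \<and> A $ i $ j \<in> \<real>"
      and sym: "ecnj ` \<mu> ` {1..l} = \<mu> ` {1..l}"
      and m_sym: "\<forall>i\<in>{1..l}. \<forall>j\<in>{1..l}. \<mu> j = ecnj (\<mu> i) \<longrightarrow> m i = m j"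
  proof -
    \<comment> \<open>The generic dyad is already real: so are \<open>c\<close>, \<open>F\<close>,
      \<open>B\<close> and, by symmetry, the coefficients of \<open>p\<close>.\<close>
    have EA: "real_mat E" "real_mat A" using real by (simp_all add: real_mat_def)
    have "real_mat F" "real_mat B" using shift_factor_real[OF P c(1) EA] by (simp_all add: F_def)
    moreover have "coeff p i \<in> \<real>" for i
      unfolding p_def
      by (rule coeff_symmetric_prod_real[OF c(1) distinct finite_atLeastAtMost sym]) (use m_sym in blast)
    ultimately have "real_vec u" "real_vec w" "real_vec (F *v u)"
      using uw(4) real_vec_mult by blast+
    hence "cvec (\<chi> i. Re ((F *v u) $ i)) = F *v u" "cvec (\<chi> i. Re (w $ i)) = w"
      by (simp_all only: real_vec_cvec)
    moreover have "complex_of_real (Re c) = c" using c(1) by simp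
    ultimately show ?thesis
      using place(1,2)[OF sf spec[OF uw(1)]]
      by (intro exI[of _ 1] exI[of _ "Re c"] exI[of _ "\<chi> i. Re ((F *v u) $ i)"]
          exI[of _ "\<chi> i. Re (w $ i)"]) (simp only: of_real_1 simp_thms)
  qed
  ultimately show ?thesis by blast
qed

end
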